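(* In the abstract setting below with $u\in L^2(\Omega;Z_0)$, let $u_h=\Lambda_hU_h$ and, for $M\in\mathbb N$, let $E_M[u_h]=\frac1M\sum_{i=1}^M\hat Y_i$ where $\hat Y_1,\dots,\hat Y_M$ are independent copies of $u_h$ (an $H$-valued random variable on $\Omega^M$). Then, with constants independent of $h\in(0,h_0)$ and $M$, $$\|\mathbb E[u]-E_M[u_h]\|_{L^2(\Omega^M;H)}\lesssim h^2+\frac1{\sqrt M},\qquad \|\mathbb E[u]-E_M[u_h]\|_{L^2(\Omega^M;V)}\lesssim h+\frac1{\sqrt M}.$$
   Context: Abstract setting. $(\Omega,\mathcal F,\mathbb P)$ a complete separable probability space; $V\hookrightarrow H$ separable Hilbert spaces, densely and continuously embedded. $a(u,\varphi)=\int_\Omega\tilde a(\omega;u(\omega),\varphi(\omega))d\mathbb P$ is a bounded, coercive bilinear form on $L^2(\Omega;V)$ and $l(\varphi)=\int_\Omega\tilde l(\omega;\varphi(\omega))d\mathbb P$ a bounded linear functional on $L^2(\Omega;H)$; $u\in L^2(\Omega;V)$ solves $a(u,\varphi)=l(\varphi)$ for all $\varphi\in L^2(\Omega;V)$. For $h\in(0,h_0)$: a finite-dimensional space $\mathcal V_h$ contained in Hilbert spaces $V_h\hookrightarrow H_h$ with $\|\chi\|_{H_h}\le c\|\chi\|_{V_h}$ uniformly in $h$; sample-dependent bilinear forms $\tilde a_h(\omega;\cdot,\cdot)$ on $V_h$ and linear functionals $\tilde l_h(\omega;\cdot)$ with $\tilde a_h(\omega;\chi,\chi)\ge c_1\|\chi\|_{V_h}^2$,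 $|\tilde a_h(\omega;\chi,W)|\le c_2\|\chi\|_{V_h}\|W\|_{V_h}$, $|\tilde l_h(\omega;\chi)|\le c_3\|\chi\|_{H_h}$, constants independent of $\omega,h$; $a_h,l_h$ are their $\mathbb P$-integrals, and $U_h\in L^2(\Omega;\mathcal V_h)$ solves $a_h(U_h,\phi_h)=l_h(\phi_h)$ for all $\phi_h\in L^2(\Omega;\mathcal V_h)$. (L1),(L2): a linear lift $\Lambda_h:\mathcal V_h\to V$ with $c_1\|\chi\|_{H_h}\le\|\Lambda_h\chi\|_H\le c_2\|\chi\|_{H_h}$ and $c_1\|\chi\|_{V_h}\le\|\Lambda_h\chi\|_V\le c_2\|\chi\|_{V_h}$, applied pathwise; $V_h^l=\Lambda_h\mathcal V_h$. (I1): a Hilbert space $Z_0\hookrightarrow V$ and $I_h:Z_0\to V_h^l$ with $\|\eta-I_h\eta\|_H+h\|\eta-I_h\eta\|_V\le ch^2\|\eta\|_{Z_0}$. Inverse lift: a linear map $w\mapsto w^{-l}$ from $V_h^l+Z_0$ into $V_h$ extending $\Lambda_h^{-1}$ (applied pathwise), and $a_h^l(w,\varphi):=a_h(w^{-l},\varphi^{-l})$, $l_h^l(\varphi):=l_h(\varphi^{-l})$. Consistency: (P1) $|l(\varphi_h)-l_h^l(\varphi_h)|\le ch^2\|\varphi_h\|_{L^2(\Omega;H)}$ for $\varphi_h\in L^2(\Omega;V_h^l)$; (P2) $|a(w,\varphi)-a_h^l(w,\varphi)|\le ch\|w\|_{L^2(\Omega;V)}\|\varphi\|_{L^2(\Omega;V)}$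 for $w,\varphi\in L^2(\Omega;V_h^l+Z_0)$; (P3) $|a(w,\varphi)-a_h^l(w,\varphi)|\le ch^2\|w\|_{L^2(\Omega;Z_0)}\|\varphi\|_{L^2(\Omega;Z_0)}$ for $w,\varphi\in L^2(\Omega;Z_0)$. (R1): for each $g\in L^2(\Omega;H)$ the dual solution $w(g)\in L^2(\Omega;V)$ of $a(\varphi,w(g))=(g,\varphi)_{L^2(\Omega;H)}$ for all $\varphi\in L^2(\Omega;V)$ lies in $L^2(\Omega;Z_0)$ with $\|w(g)\|_{L^2(\Omega;Z_0)}\le c\|g\|_{L^2(\Omega;H)}$. All constants are independent of $h$. *)

theory Defs
  imports "HOL-Analysis.Analysis" "HOL-Probability.Probability"
begin

definition L2 :: "'a measure \<Rightarrow> ('b::topological_space \<Rightarrow> real) \<Rightarrow> 'b set \<Rightarrow> ('a \<Rightarrow> 'b) set" where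
  "L2 P N S = {f. f \<in> borel_measurable P \<and> (\<forall>\<omega>\<in>space P. f \<omega> \<in> S)
                  \<and> integrable P (\<lambda>\<omega>. (N (f \<omega>))\<^sup>2)}"

definition L2norm :: "'a measure \<Rightarrow> ('b \<Rightarrow> real) \<Rightarrow> ('a \<Rightarrow> 'b) \<Rightarrow> real" where
  "L2norm P N f = sqrt (\<integral>\<omega>. (N (f \<omega>))\<^sup>2 \<partial>P)"

definition ip_norm :: "('d \<Rightarrow> 'd \<Rightarrow> real) \<Rightarrow> 'd \<Rightarrow> real" where
  "ip_norm ip x = sqrt (ip x x)"

definition inner_product_on :: "'d::real_vector set \<Rightarrow> ('d \<Rightarrow> 'd \<Rightarrow> real) \<Rightarrow> bool" where
  "inner_product_on S ip \<longleftrightarrow>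
     (\<forall>x\<in>S. \<forall>y\<in>S. ip x y = ip y x)
   \<and> (\<forall>x\<in>S. \<forall>y\<in>S. \<forall>z\<in>S. ip (x + y) z = ip x z + ip y z)
   \<and> (\<forall>r. \<forall>x\<in>S. \<forall>y\<in>S. ip (r *\<^sub>R x) y = r * ip x y)
   \<and> (\<forall>x\<in>S. 0 \<le> ip x x \<and> (ip x x = 0 \<longrightarrow> x = 0))"

definition hilbert_on :: "'d::real_vector set \<Rightarrow> ('d \<Rightarrow> 'd \<Rightarrow> real) \<Rightarrow> bool" where
  "hilbert_on S ip \<longleftrightarrow> subspace S \<and> inner_product_on S ip \<and>
     (\<forall>f. (\<forall>n. f n \<in> S) \<and> (\<forall>e>0. \<exists>N. \<forall>m\<ge>N. \<forall>n\<ge>N. ip_norm ip (f m - f n) < e)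
          \<longrightarrow> (\<exists>x\<in>S. (\<lambda>n. ip_norm ip (f n - x)) \<longlonglongrightarrow> 0))"

definition bilinear_on :: "'d::real_vector set \<Rightarrow> ('d \<Rightarrow> 'd \<Rightarrow> real) \<Rightarrow> bool" where
  "bilinear_on S B \<longleftrightarrow>
     (\<forall>x\<in>S. \<forall>y\<in>S. \<forall>z\<in>S. B (x + y) z = B x z + B y z \<and> B z (x + y) = B z x + B z y)
   \<and> (\<forall>r. \<forall>x\<in>S. \<forall>y\<in>S. B (r *\<^sub>R x) y = r * B x y \<and> B x (r *\<^sub>R y) = r * B x y)"

definition linear_on :: "'d::real_vector set \<Rightarrow> ('d \<Rightarrow> 'e::real_vector) \<Rightarrow> bool" where
  "linear_on S f \<longleftrightarrow> (\<forall>x\<in>S. \<forall>y\<in>S. f (x + y) = f x + f y) \<and> (\<forall>r. \<forall>x\<in>S. f (r *\<^sub>R x) = r *\<^sub>R f x)"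

definition fun_bilinear_on :: "('a \<Rightarrow> 'v::real_vector) set \<Rightarrow> (('a \<Rightarrow> 'v) \<Rightarrow> ('a \<Rightarrow> 'v) \<Rightarrow> real) \<Rightarrow> bool" where
  "fun_bilinear_on F B \<longleftrightarrow>
     (\<forall>x\<in>F. \<forall>y\<in>F. \<forall>z\<in>F. B (\<lambda>\<omega>. x \<omega> + y \<omega>) z = B x z + B y z
                       \<and> B z (\<lambda>\<omega>. x \<omega> + y \<omega>) = B z x + B z y)
   \<and> (\<forall>r. \<forall>x\<in>F. \<forall>y\<in>F. B (\<lambda>\<omega>. r *\<^sub>R x \<omega>) y = r * B x y \<and> B x (\<lambda>\<omega>. r *\<^sub>R y \<omega>) = r * B x y)"

definition fun_linear_on :: "('a \<Rightarrow> 'v::real_vector) set \<Rightarrow> (('a \<Rightarrow> 'v) \<Rightarrow> real) \<Rightarrow> bool" where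
  "fun_linear_on F L \<longleftrightarrow>
     (\<forall>x\<in>F. \<forall>y\<in>F. L (\<lambda>\<omega>. x \<omega> + y \<omega>) = L x + L y)
   \<and> (\<forall>r. \<forall>x\<in>F. L (\<lambda>\<omega>. r *\<^sub>R x \<omega>) = r * L x)"

definition bform :: "'a measure \<Rightarrow> ('a \<Rightarrow> 'b \<Rightarrow> 'b \<Rightarrow> real) \<Rightarrow> ('a \<Rightarrow> 'b) \<Rightarrow> ('a \<Rightarrow> 'b) \<Rightarrow> real" where
  "bform P B x y = (\<integral>\<omega>. B \<omega> (x \<omega>) (y \<omega>) \<partial>P)"

definition lform :: "'a measure \<Rightarrow> ('a \<Rightarrow> 'b \<Rightarrow> real) \<Rightarrow> ('a \<Rightarrow> 'b) \<Rightarrow> real" where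
  "lform P L x = (\<integral>\<omega>. L \<omega> (x \<omega>) \<partial>P)"

definition separable_measure :: "'a measure \<Rightarrow> bool" where
  "separable_measure P \<longleftrightarrow> (\<exists>C. countable C \<and> C \<subseteq> sets P \<and>
     (\<forall>A\<in>sets P. \<forall>e>0. \<exists>B\<in>C. measure P ((A - B) \<union> (B - A)) < e))"

definition lift_plus_Z :: "('d \<Rightarrow> 'v::real_vector) \<Rightarrow> 'd set \<Rightarrow> ('z \<Rightarrow> 'v) \<Rightarrow> 'v set" where
  "lift_plus_Z lift Vs embZ = {x + embZ z | x z. x \<in> lift ` Vs}"

text \<open>Monte Carlo estimator (1/M) sum_{i<M} Y(omega_i) on the product space Omega^M
  (coordinates omega_0..omega_{M-1} are i.i.d. copies).\<close>
definition mc_mean :: "nat \<Rightarrow> ('a \<Rightarrow> 'v::real_vector) \<Rightarrow> (nat \<Rightarrow> 'a) \<Rightarrow> 'v" where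
  "mc_mean m Y \<omega>s = (1 / real m) *\<^sub>R (\<Sum>i<m. Y (\<omega>s i))"

end

theory Submission
  imports Defs
begin

text \<open>
  With \<open>\<Pi>\<close> the \<open>V\<close>-orthogonal projection onto the lifted discrete space, coercivity of the discrete form
  tested with \<open>u\<^sub>h - \<Pi>u\<close> gives the \<open>O(h)\<close> bound in \<open>V\<close> (Strang), and the dual solution for the
  right-hand side \<open>u - u\<^sub>h\<close>, which exists by Lax--Milgram in \<open>L\<^sup>2(\<Omega>;V)\<close>, improves it to \<open>O(h\<^sup>2)\<close> in \<open>H\<close>
  (Aubin--Nitsche). The projection replaces the interpolation \<open>I\<^sub>h\<close>, because \<open>I\<^sub>h\<close> need not
  be measurable; only its approximation order in \<open>V\<close> matters. The sampling error is orthogonal to the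
  bias and has second moment at most \<open>E|u\<^sub>h|\<^sup>2 / M\<close>.
\<close>

section \<open>Square-integrable functions\<close>

text \<open>Measurability and exceptional null sets shape most of the development. Borel sets of
  \<open>'d\<close> come from its own norm, while the lift and the inverse lift are controlled only
  through the norms given by \<open>ipV\<close> and \<open>ipH\<close>, and nothing relates these
  norms on all of \<open>'d\<close>. Measurability of lifted functions therefore rests on the finite
  dimension of \<open>Vsp h\<close>: linear maps on a finite span are continuous there. Likewise
  \<open>u\<close> and the dual solution lie in Z_0 only almost everywhere, whereas (P2) and (P3)
  ask for values in the right space at every sample; both are replaced by representatives of the
  form \<open>embZ\<close> of a Z_0-valued function. Two analytic points remain. The lifted discrete
  form is needed on the sum of lifts and Z_0, where it inherits its bound from (P2) and the bound of
  \<open>a\<close>. And (P2) alone would lose one order in the duality argument: the consistency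
  error at the exact primal and dual solutions goes to (P3), and every term left to (P2) has a
  second factor of order h.\<close>

text \<open>The sort of Hilbert spaces used here, \<open>{real_inner, complete_space}\<close>, is not a subsort of
  \<open>banach\<close>, so the library criteria for Bochner integrability do not apply to it.\<close>
lemma integrable_complete_space:
  fixes f :: "'a \<Rightarrow> 'b::{real_normed_vector,complete_space,second_countable_topology}"
  assumes f[measurable]: "f \<in> borel_measurable M" and nf: "integrable M (\<lambda>x. norm (f x))"
  shows "integrable M f"
proof -
  obtain s where s: "\<And>i. simple_function M (s i)"
    and lim: "\<And>x. x \<in> space M \<Longrightarrow> (\<lambda>i. s i x) \<longlonglongrightarrow> f x"
    and bnd: "\<And>i x. x \<in> space M \<Longrightarrow> norm (s i x) \<le> 2 * norm (f x)"
    using borel_measurable_implies_sequence_metric[OF f, of 0] by simp metis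
  have sm[measurable]: "s i \<in> borel_measurable M" for i
    using s by (rule borel_measurable_simple_function)
  have fin: "(\<integral>\<^sup>+x. ennreal (2 * norm (f x)) \<partial>M) < \<infinity>"
    using nf by (simp add: integrable_iff_bounded nn_integral_cmult ennreal_mult ennreal_mult_less_top)
  have sb: "Bochner_Integration.simple_bochner_integrable M (s i)" for i
  proof (rule simple_bochner_integrableI_bounded[OF s])
    have "(\<integral>\<^sup>+x. norm (s i x) \<partial>M) \<le> (\<integral>\<^sup>+x. ennreal (2 * norm (f x)) \<partial>M)"
      by (intro nn_integral_mono) (simp add: bnd)
    then show "(\<integral>\<^sup>+x. norm (s i x) \<partial>M) < \<infinity>" using fin by (rule le_less_trans)
  qed
  let ?S = "\<lambda>i. \<integral>\<^sup>+x. ennreal (norm (f x - s i x)) \<partial>M"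
  let ?I = "\<lambda>i. Bochner_Integration.simple_bochner_integral M (s i)"
  have S0: "?S \<longlonglongrightarrow> 0"
    using fin by (intro nn_integral_dominated_convergence_norm[where w="\<lambda>x. 2 * norm (f x)"])
      (auto simp: bnd lim)
  \<comment> \<open>The integrals of two approximating simple functions differ by at most the sum of
    their L1 distances to \<open>f\<close>. Completeness of the target space then supplies the value
    of the integral.\<close>
  have "Cauchy ?I"
  proof (rule metric_CauchyI)
    fix e :: real assume e: "0 < e"
    then obtain K where K: "\<And>n. n \<ge> K \<Longrightarrow> ?S n < ennreal (e / 2)"
      using order_tendstoD(2)[OF S0, of "ennreal (e / 2)"] by (auto simp: eventually_sequentially)
    have "dist (?I m) (?I n) < e" if mn: "m \<ge> K" "n \<ge> K" for m n
    proof -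
      have "ennreal (norm (?I m - ?I n)) \<le> ?S m + ?S n"
        by (intro simple_bochner_integral_bounded sb f)
      also have "\<dots> < ennreal (e / 2) + ennreal (e / 2)"
        by (intro add_strict_mono K mn)
      also have "\<dots> = ennreal e" using e by (simp flip: ennreal_plus)
      finally show ?thesis using e by (simp add: dist_norm ennreal_less_iff)
    qed
    then show "\<exists>K. \<forall>m\<ge>K. \<forall>n\<ge>K. dist (?I m) (?I n) < e" by blast
  qed
  then obtain y where "?I \<longlonglongrightarrow> y" using Cauchy_convergent convergent_def by blast
  then have "has_bochner_integral M f y" by (intro has_bochner_integral.intros[OF f sb S0])
  then show ?thesis by (rule integrable.intros)
qed

lemma L2_I:
  "f \<in> borel_measurable P \<Longrightarrow> (\<And>\<omega>. \<omega> \<in> space P \<Longrightarrow> f \<omega> \<in> S)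
    \<Longrightarrow> integrable P (\<lambda>\<omega>. (N (f \<omega>))\<^sup>2) \<Longrightarrow> f \<in> L2 P N S"
  by (simp add: L2_def)

lemma L2_D:
  assumes "f \<in> L2 P N S"
  shows L2_measurable: "f \<in> borel_measurable P" and L2_in: "\<omega> \<in> space P \<Longrightarrow> f \<omega> \<in> S"
    and L2_integrable: "integrable P (\<lambda>\<omega>. (N (f \<omega>))\<^sup>2)"
  using assms by (auto simp: L2_def)

lemma L2_mono: "f \<in> L2 P N S \<Longrightarrow> S \<subseteq> T \<Longrightarrow> f \<in> L2 P N T"
  by (auto simp: L2_def)

lemma L2norm_nonneg: "0 \<le> L2norm P N f"
  by (simp add: L2norm_def)

lemma L2norm_power2: "(L2norm P N f)\<^sup>2 = (\<integral>\<omega>. (N (f \<omega>))\<^sup>2 \<partial>P)"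
  by (simp add: L2norm_def)

text \<open>The comparison function may live in another space and be measured by any
  \<open>N\<close>. One statement thus covers the embeddings, the projection and the lift, where
  \<open>N\<close> is the discrete norm. Measurability of \<open>f\<close> is a separate hypothesis
  because domination does not give it.\<close>

lemma L2_dominated:
  fixes f :: "'a \<Rightarrow> 'b::{real_normed_vector,second_countable_topology}" and N :: "'c::topological_space \<Rightarrow> real"
  assumes f: "f \<in> borel_measurable P" "\<And>\<omega>. \<omega> \<in> space P \<Longrightarrow> f \<omega> \<in> S"
    and g: "g \<in> L2 P N T" and K: "0 \<le> K"
    and le: "\<And>\<omega>. \<omega> \<in> space P \<Longrightarrow> norm (f \<omega>) \<le> K * N (g \<omega>)"
  shows L2_dominated_mem: "f \<in> L2 P norm S"
    and L2_dominated_norm: "L2norm P norm f \<le> K * L2norm P N g"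
proof -
  have g2: "integrable P (\<lambda>\<omega>. K\<^sup>2 * (N (g \<omega>))\<^sup>2)" using L2_integrable[OF g] by simp
  have le2: "(norm (f \<omega>))\<^sup>2 \<le> K\<^sup>2 * (N (g \<omega>))\<^sup>2" if "\<omega> \<in> space P" for \<omega>
    using power_mono[OF le[OF that], of 2] by (simp add: power_mult_distrib)
  have fi: "integrable P (\<lambda>\<omega>. (norm (f \<omega>))\<^sup>2)"
    using g2 by (rule Bochner_Integration.integrable_bound) (use f le2 in auto)
  then show "f \<in> L2 P norm S" using f by (intro L2_I) auto
  have "(\<integral>\<omega>. (norm (f \<omega>))\<^sup>2 \<partial>P) \<le> (\<integral>\<omega>. K\<^sup>2 * (N (g \<omega>))\<^sup>2 \<partial>P)"
    by (intro integral_mono fi g2 le2)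
  then have "L2norm P norm f \<le> sqrt (K\<^sup>2 * (\<integral>\<omega>. (N (g \<omega>))\<^sup>2 \<partial>P))"
    by (simp add: L2norm_def)
  then show "L2norm P norm f \<le> K * L2norm P N g"
    using K by (simp add: L2norm_def real_sqrt_mult)
qed

lemma L2_add:
  fixes f g :: "'a \<Rightarrow> 'b::{real_normed_vector,second_countable_topology}"
  assumes f: "f \<in> L2 P norm S" and g: "g \<in> L2 P norm T"
  shows "(\<lambda>\<omega>. f \<omega> + g \<omega>) \<in> L2 P norm UNIV"
proof (rule L2_I)
  note [measurable] = L2_measurable[OF f] L2_measurable[OF g]
  show "(\<lambda>\<omega>. f \<omega> + g \<omega>) \<in> borel_measurable P" by measurable
  have i: "integrable P (\<lambda>\<omega>. 2 * (norm (f \<omega>))\<^sup>2 + 2 * (norm (g \<omega>))\<^sup>2)"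
    using L2_integrable[OF f] L2_integrable[OF g] by simp
  have "(norm (f \<omega> + g \<omega>))\<^sup>2 \<le> 2 * (norm (f \<omega>))\<^sup>2 + 2 * (norm (g \<omega>))\<^sup>2" for \<omega>
  proof -
    have "(norm (f \<omega> + g \<omega>))\<^sup>2 \<le> (norm (f \<omega>) + norm (g \<omega>))\<^sup>2"
      by (intro power_mono norm_triangle_ineq norm_ge_zero)
    also have "\<dots> \<le> 2 * (norm (f \<omega>))\<^sup>2 + 2 * (norm (g \<omega>))\<^sup>2"
      using sum_squares_bound[of "norm (f \<omega>)" "norm (g \<omega>)"] by (simp add: power2_sum)
    finally show ?thesis .
  qed
  then show "integrable P (\<lambda>\<omega>. (norm (f \<omega> + g \<omega>))\<^sup>2)"
    by (intro Bochner_Integration.integrable_bound[OF i]) (auto intro!: AE_I2 order_trans[OF _ abs_ge_self])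
qed simp

lemma L2_bounded_linear:
  fixes f :: "'a \<Rightarrow> 'b::{real_normed_vector,second_countable_topology}"
    and T :: "'b \<Rightarrow> 'c::{real_normed_vector,second_countable_topology}"
  assumes T: "bounded_linear T" and f: "f \<in> L2 P norm S"
  shows "(\<lambda>\<omega>. T (f \<omega>)) \<in> L2 P norm UNIV"
proof -
  obtain K where K: "0 \<le> K" "\<And>x. norm (T x) \<le> K * norm x"
    using bounded_linear.nonneg_bounded[OF T] by (auto simp: mult.commute)
  have "(\<lambda>\<omega>. T (f \<omega>)) \<in> borel_measurable P"
    using borel_measurable_continuous_onI[OF bounded_linear.continuous_on[OF T continuous_on_id]]
      L2_measurable[OF f] measurable_compose by blast
  then show ?thesis by (rule L2_dominated_mem[OF _ _ f K(1)]) (auto simp: K)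
qed

lemma L2_scaleR:
  fixes f :: "'a \<Rightarrow> 'b::{real_normed_vector,second_countable_topology}"
  shows "f \<in> L2 P norm S \<Longrightarrow> (\<lambda>\<omega>. r *\<^sub>R f \<omega>) \<in> L2 P norm UNIV"
  by (rule L2_bounded_linear[OF bounded_linear_scaleR_right])

lemma L2_diff:
  fixes f g :: "'a \<Rightarrow> 'b::{real_normed_vector,second_countable_topology}"
  assumes f: "f \<in> L2 P norm S" and g: "g \<in> L2 P norm T"
  shows "(\<lambda>\<omega>. f \<omega> - g \<omega>) \<in> L2 P norm UNIV"
  using L2_add[OF f L2_scaleR[OF g, of "-1"]] by simp

lemma L2_restrict:
  "f \<in> L2 P N UNIV \<Longrightarrow> (\<And>\<omega>. \<omega> \<in> space P \<Longrightarrow> f \<omega> \<in> S) \<Longrightarrow> f \<in> L2 P N S"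
  by (auto simp: L2_def)

lemma L2_inner_integrable:
  fixes f g :: "'a \<Rightarrow> 'b::{real_inner,second_countable_topology}"
  assumes f: "f \<in> L2 P norm S" and g: "g \<in> L2 P norm T"
  shows "integrable P (\<lambda>\<omega>. f \<omega> \<bullet> g \<omega>)"
proof -
  note [measurable] = L2_measurable[OF f] L2_measurable[OF g]
  have i: "integrable P (\<lambda>\<omega>. (norm (f \<omega>))\<^sup>2 + (norm (g \<omega>))\<^sup>2)"
    using L2_integrable[OF f] L2_integrable[OF g] by simp
  have "\<bar>f \<omega> \<bullet> g \<omega>\<bar> \<le> (norm (f \<omega>))\<^sup>2 + (norm (g \<omega>))\<^sup>2" for \<omega>
    using Cauchy_Schwarz_ineq2[of "f \<omega>" "g \<omega>"] sum_squares_bound[of "norm (f \<omega>)" "norm (g \<omega>)"]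
      mult_nonneg_nonneg[OF norm_ge_zero[of "f \<omega>"] norm_ge_zero[of "g \<omega>"]] by linarith
  then show ?thesis
    by (intro Bochner_Integration.integrable_bound[OF i]) (auto intro!: AE_I2)
qed

section \<open>Lax--Milgram in semi-inner product spaces\<close>

text \<open>Functions that agree almost everywhere are not identified, hence only a semi-inner product; the
  carrier operations need no vector space laws, since only their images under \<open>ip\<close> matter.\<close>
locale semi_inner_space =
  fixes F :: "'f set" and add :: "'f \<Rightarrow> 'f \<Rightarrow> 'f" and scl :: "real \<Rightarrow> 'f \<Rightarrow> 'f"
    and ip :: "'f \<Rightarrow> 'f \<Rightarrow> real"
  assumes add_closed: "x \<in> F \<Longrightarrow> y \<in> F \<Longrightarrow> add x y \<in> F"
    and scl_closed: "x \<in> F \<Longrightarrow> scl r x \<in> F"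
    and F_nonempty: "F \<noteq> {}"
    and ip_sym: "x \<in> F \<Longrightarrow> y \<in> F \<Longrightarrow> ip x y = ip y x"
    and ip_add: "x \<in> F \<Longrightarrow> y \<in> F \<Longrightarrow> z \<in> F \<Longrightarrow> ip (add x y) z = ip x z + ip y z"
    and ip_scl: "x \<in> F \<Longrightarrow> y \<in> F \<Longrightarrow> ip (scl r x) y = r * ip x y"
    and ip_nonneg: "x \<in> F \<Longrightarrow> 0 \<le> ip x x"
begin

definition sub :: "'f \<Rightarrow> 'f \<Rightarrow> 'f" where "sub x y = add x (scl (-1) y)"

lemma sub_closed: "x \<in> F \<Longrightarrow> y \<in> F \<Longrightarrow> sub x y \<in> F"
  by (simp add: sub_def add_closed scl_closed)

lemma ip_add_right: "x \<in> F \<Longrightarrow> y \<in> F \<Longrightarrow> z \<in> F \<Longrightarrow> ip z (add x y) = ip z x + ip z y"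
  by (metis add_closed ip_add ip_sym)

lemma ip_scl_right: "x \<in> F \<Longrightarrow> y \<in> F \<Longrightarrow> ip y (scl r x) = r * ip y x"
  by (metis scl_closed ip_scl ip_sym)

lemma ip_sub: "x \<in> F \<Longrightarrow> y \<in> F \<Longrightarrow> z \<in> F \<Longrightarrow> ip (sub x y) z = ip x z - ip y z"
  by (simp add: sub_def ip_add ip_scl scl_closed)

lemma ip_sub_right: "x \<in> F \<Longrightarrow> y \<in> F \<Longrightarrow> z \<in> F \<Longrightarrow> ip z (sub x y) = ip z x - ip z y"
  by (simp add: sub_def ip_add_right ip_scl_right scl_closed)

lemmas ip_simps = ip_add ip_scl ip_sub ip_add_right ip_scl_right ip_sub_right
  add_closed scl_closed sub_closed

text \<open>A vector with \<open>ip y y = 0\<close> need not be zero, and the usual minimising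
  \<open>t\<close> does not exist for it. The quadratic is then affine in \<open>t\<close>, and
  nonnegativity forces its slope to vanish.\<close>

lemma Cauchy_Schwarz_ip:
  assumes "x \<in> F" "y \<in> F"
  shows "\<bar>ip x y\<bar> \<le> sqrt (ip x x) * sqrt (ip y y)"
proof -
  have q: "0 \<le> ip x x + 2 * t * ip x y + t\<^sup>2 * ip y y" for t
    using ip_nonneg[of "add x (scl t y)"] assms ip_sym[OF assms]
    by (simp add: ip_simps algebra_simps power2_eq_square)
  have "(ip x y)\<^sup>2 \<le> ip x x * ip y y"
  proof (cases "ip y y = 0")
    case True
    have "ip x y = 0"
    proof (rule ccontr)
      assume n: "ip x y \<noteq> 0"
      \<comment> \<open>This \<open>t\<close> makes the affine function equal to -1.\<close>
      show False using q[of "- (ip x x + 1) / (2 * ip x y)"] n True by (simp add: field_simps)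
    qed
    then show ?thesis by (simp add: True)
  next
    case False
    then have "ip y y > 0" using ip_nonneg[OF assms(2)] by simp
    then show ?thesis using q[of "- ip x y / ip y y"] by (simp add: field_simps power2_eq_square)
  qed
  then have "sqrt ((ip x y)\<^sup>2) \<le> sqrt (ip x x * ip y y)" by (rule real_sqrt_le_mono)
  then show ?thesis by (simp add: real_sqrt_mult)
qed

lemma sqrt_ip_triangle:
  assumes "x \<in> F" "y \<in> F"
  shows "sqrt (ip (add x y) (add x y)) \<le> sqrt (ip x x) + sqrt (ip y y)"
proof (rule real_le_lsqrt)
  show "0 \<le> sqrt (ip x x) + sqrt (ip y y)" using assms by (simp add: ip_nonneg)
  show "ip (add x y) (add x y) \<le> (sqrt (ip x x) + sqrt (ip y y))\<^sup>2"
    using Cauchy_Schwarz_ip[OF assms] assms ip_sym[OF assms]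
    by (simp add: ip_simps power2_sum ip_nonneg)
qed

end

locale semi_hilbert_space = semi_inner_space +
  assumes complete_ip:
    "(\<And>n::nat. X n \<in> F) \<Longrightarrow> (\<And>e. e > 0 \<Longrightarrow> \<exists>N. \<forall>m\<ge>N. \<forall>n\<ge>N. ip (sub (X m) (X n)) (sub (X m) (X n)) < e)
      \<Longrightarrow> \<exists>x\<in>F. (\<lambda>n. ip (sub (X n) x) (sub (X n) x)) \<longlonglongrightarrow> 0"
begin

text \<open>The representer minimises \<open>ip x x - 2 * L x\<close>; by the parallelogram law every minimising
  sequence is Cauchy.\<close>
theorem Riesz_representation:
  assumes L_add: "\<And>x y. x \<in> F \<Longrightarrow> y \<in> F \<Longrightarrow> L (add x y) = L x + L y"
    and L_scl: "\<And>r x. x \<in> F \<Longrightarrow> L (scl r x) = r * L x"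
    and L_bdd: "\<And>x. x \<in> F \<Longrightarrow> \<bar>L x\<bar> \<le> K * sqrt (ip x x)"
  shows "\<exists>w\<in>F. \<forall>\<phi>\<in>F. ip w \<phi> = L \<phi>"
proof -
  define J where "J x = ip x x - 2 * L x" for x
  \<comment> \<open>With \<open>s = sqrt (ip x x)\<close> the bound on \<open>L\<close> gives
    \<open>J x \<ge> s^2 - 2 * K * s\<close>; completing the square leaves
    \<open>- K^2\<close>.\<close>
  have "- K\<^sup>2 \<le> J x" if "x \<in> F" for x
    using L_bdd[OF that] ip_nonneg[OF that] zero_le_power2[of "sqrt (ip x x) - K"]
    by (auto simp: J_def power2_diff mult.commute)
  then have bb: "bdd_below (J ` F)" by (intro bdd_belowI2)
  define d where "d = Inf (J ` F)"
  have dJ: "d \<le> J x" if "x \<in> F" for x unfolding d_def using bb that by (rule cINF_lower)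
  have "\<exists>x\<in>F. J x < d + 1 / real (Suc n)" for n
    using cInf_lessD[of "J ` F" "d + 1 / real (Suc n)"] F_nonempty by (auto simp: d_def)
  then obtain X where X: "\<And>n. X n \<in> F" "\<And>n. J (X n) < d + 1 / real (Suc n)" by metis
  have par: "ip (sub (X m) (X n)) (sub (X m) (X n)) \<le> 2 / real (Suc m) + 2 / real (Suc n)" for m n
  proof -
    let ?z = "scl (1/2) (add (X m) (X n))"
    have "d \<le> J ?z" by (intro dJ) (simp add: X ip_simps)
    \<comment> \<open>The linear parts cancel at the midpoint, so the parallelogram law holds with
      \<open>J\<close> in place of the squared seminorm; \<open>d \<le> J ?z\<close> turns it into a
      bound on the distance.\<close>
    moreover have "ip (sub (X m) (X n)) (sub (X m) (X n)) = 2 * J (X m) + 2 * J (X n) - 4 * J ?z"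
      using X ip_sym[of "X m" "X n"] by (simp add: J_def ip_simps L_add L_scl field_simps)
    ultimately show ?thesis using X(2)[of m] X(2)[of n] by simp
  qed
  have inv0: "(\<lambda>n. 1 / real (Suc n)) \<longlonglongrightarrow> 0"
    using LIMSEQ_inverse_real_of_nat by (simp add: inverse_eq_divide)
  have "\<exists>N. \<forall>m\<ge>N. \<forall>n\<ge>N. ip (sub (X m) (X n)) (sub (X m) (X n)) < e" if e: "e > 0" for e
  proof -
    obtain N where N: "\<And>n. n \<ge> N \<Longrightarrow> 1 / real (Suc n) < e / 4"
      using order_tendstoD(2)[OF inv0, of "e / 4"] e by (auto simp: eventually_sequentially)
    have "ip (sub (X m) (X n)) (sub (X m) (X n)) < e" if "m \<ge> N" "n \<ge> N" for m n
      using par[of m n] N[OF that(1)] N[OF that(2)] by simp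
    then show ?thesis by blast
  qed
  then obtain w where w: "w \<in> F" and lim: "(\<lambda>n. ip (sub (X n) w) (sub (X n) w)) \<longlonglongrightarrow> 0"
    using complete_ip[of X] X(1) by blast
  have "ip w \<phi> = L \<phi>" if \<phi>: "\<phi> \<in> F" for \<phi>
  proof -
    define r where "r = ip w \<phi> - L \<phi>"
    define q where "q = ip \<phi> \<phi>"
    have "(\<lambda>n. ip (sub (X n) w) \<phi>) \<longlonglongrightarrow> 0"
    proof (rule Lim_null_comparison)
      show "\<forall>\<^sub>F n in sequentially. norm (ip (sub (X n) w) \<phi>) \<le> sqrt (ip (sub (X n) w) (sub (X n) w)) * sqrt q"
        using Cauchy_Schwarz_ip X w \<phi> by (simp add: sub_closed q_def)
      show "(\<lambda>n. sqrt (ip (sub (X n) w) (sub (X n) w)) * sqrt q) \<longlonglongrightarrow> 0"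
        using tendsto_mult_left_zero[OF tendsto_real_sqrt[OF lim, unfolded real_sqrt_zero]] .
    qed
    then have "(\<lambda>n. ip (X n) \<phi> - ip w \<phi>) \<longlonglongrightarrow> 0"
      using X w \<phi> by (simp add: ip_sub)
    then have conv: "(\<lambda>n. ip (X n) \<phi>) \<longlonglongrightarrow> ip w \<phi>" by (simp add: LIM_zero_iff)
    \<comment> \<open>The infimum \<open>d\<close> is compared with \<open>J\<close> at
      \<open>X n + t \<phi>\<close>, where \<open>1 / Suc n\<close> bounds the distance of
      \<open>J (X n)\<close> from \<open>d\<close>. Only \<open>ip (X n) \<phi>\<close> has to
      converge in the limit.\<close>
    have nn: "0 \<le> t\<^sup>2 * q + 2 * t * r" for t
    proof (rule LIMSEQ_le_const)
      show "(\<lambda>n. t\<^sup>2 * q + 2 * t * (ip (X n) \<phi> - L \<phi>) + 1 / real (Suc n)) \<longlonglongrightarrow> t\<^sup>2 * q + 2 * t * r"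
        using tendsto_add[OF tendsto_add[OF tendsto_const[of "t\<^sup>2 * q"]
            tendsto_mult_left[OF tendsto_diff[OF conv tendsto_const[of "L \<phi>"]], of "2 * t"]] inv0]
        by (simp add: r_def)
      have "0 \<le> t\<^sup>2 * q + 2 * t * (ip (X n) \<phi> - L \<phi>) + 1 / real (Suc n)" for n
      proof -
        have "d \<le> J (add (X n) (scl t \<phi>))" by (intro dJ) (simp add: X \<phi> ip_simps)
        also have "\<dots> = J (X n) + t\<^sup>2 * q + 2 * t * (ip (X n) \<phi> - L \<phi>)"
          using X \<phi> ip_sym[of "X n" \<phi>]
          by (simp add: J_def ip_simps L_add L_scl q_def algebra_simps power2_eq_square)
        finally show ?thesis using X(2)[of n] by simp
      qed
      then show "\<exists>N. \<forall>n\<ge>N. 0 \<le> t\<^sup>2 * q + 2 * t * (ip (X n) \<phi> - L \<phi>) + 1 / real (Suc n)" by blast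
    qed
    have q: "0 \<le> q" using ip_nonneg[OF \<phi>] by (simp add: q_def)
    \<comment> \<open>\<open>q\<close> may be 0, so the shift by 1 keeps the denominator positive;
      \<open>nn\<close> then reads \<open>0 \<le> - t^2 * (q + 2)\<close>.\<close>
    define t where "t = - r / (q + 1)"
    have r: "r = - (q + 1) * t" using q by (simp add: t_def field_simps)
    have "t\<^sup>2 * (q + 2) \<le> 0"
      using nn[of t] unfolding r by (simp add: algebra_simps power2_eq_square)
    then have "t = 0" using q by (simp add: mult_le_0_iff)
    then have "r = 0" by (simp add: r)
    then show ?thesis by (simp add: r_def)
  qed
  then show ?thesis using w by blast
qed

text \<open>If \<open>R w\<close> represents \<open>B \<sqdot> w\<close>, then \<open>ip (R x) (R y)\<close> is an equivalent
  inner product. Representing \<open>\<lambda>y. ip l (R y)\<close> in it gives a \<open>w\<close> whose residual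
  \<open>R w - l\<close> is \<open>B\<close>-orthogonal to everything, in particular to itself.\<close>
theorem Lax_Milgram:
  assumes B_add: "\<And>x y z. x \<in> F \<Longrightarrow> y \<in> F \<Longrightarrow> z \<in> F \<Longrightarrow> B (add x y) z = B x z + B y z"
    and B_add_right: "\<And>x y z. x \<in> F \<Longrightarrow> y \<in> F \<Longrightarrow> z \<in> F \<Longrightarrow> B z (add x y) = B z x + B z y"
    and B_scl: "\<And>r x y. x \<in> F \<Longrightarrow> y \<in> F \<Longrightarrow> B (scl r x) y = r * B x y"
    and B_scl_right: "\<And>r x y. x \<in> F \<Longrightarrow> y \<in> F \<Longrightarrow> B x (scl r y) = r * B x y"
    and B_bdd: "\<And>x y. x \<in> F \<Longrightarrow> y \<in> F \<Longrightarrow> \<bar>B x y\<bar> \<le> C * sqrt (ip x x) * sqrt (ip y y)"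
    and c: "c > 0" and B_coer: "\<And>x. x \<in> F \<Longrightarrow> c * ip x x \<le> B x x"
    and L_add: "\<And>x y. x \<in> F \<Longrightarrow> y \<in> F \<Longrightarrow> L (add x y) = L x + L y"
    and L_scl: "\<And>r x. x \<in> F \<Longrightarrow> L (scl r x) = r * L x"
    and L_bdd: "\<And>x. x \<in> F \<Longrightarrow> \<bar>L x\<bar> \<le> K * sqrt (ip x x)"
  shows "\<exists>w\<in>F. \<forall>\<phi>\<in>F. B \<phi> w = L \<phi>"
proof -
  obtain l where l: "l \<in> F" "\<And>\<phi>. \<phi> \<in> F \<Longrightarrow> ip l \<phi> = L \<phi>"
    using Riesz_representation[of L K] L_add L_scl L_bdd by blast
  have "\<exists>v\<in>F. \<forall>\<phi>\<in>F. ip v \<phi> = B \<phi> x" if "x \<in> F" for x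
  proof (rule Riesz_representation)
    show "\<bar>B y x\<bar> \<le> (C * sqrt (ip x x)) * sqrt (ip y y)" if "y \<in> F" for y
      using B_bdd[OF that \<open>x \<in> F\<close>] by (simp add: ac_simps)
  qed (use that B_add B_scl in auto)
  then obtain R where R: "\<And>x. x \<in> F \<Longrightarrow> R x \<in> F" "\<And>x \<phi>. x \<in> F \<Longrightarrow> \<phi> \<in> F \<Longrightarrow> ip (R x) \<phi> = B \<phi> x"
    by metis
  have R': "ip \<phi> (R x) = B \<phi> x" if "x \<in> F" "\<phi> \<in> F" for x \<phi>
    using R[OF that(1)] that ip_sym by metis
  \<comment> \<open>Coercivity bounds \<open>R\<close> from below and boundedness of
    \<open>B\<close> bounds it from above, so \<open>x\<close> and \<open>R x\<close> have
    equivalent seminorms. Both bounds first appear multiplied by a factor that may be zero, hence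
    the case splits at the end.\<close>
  have lower: "c\<^sup>2 * ip x x \<le> ip (R x) (R x)" if x: "x \<in> F" for x
  proof -
    have "(c * ip x x)\<^sup>2 \<le> (ip (R x) x)\<^sup>2"
      using B_coer[OF x] R(2)[OF x x] c ip_nonneg[OF x] by (intro power_mono) auto
    also have "\<dots> \<le> (sqrt (ip (R x) (R x)) * sqrt (ip x x))\<^sup>2"
      using Cauchy_Schwarz_ip[OF R(1)[OF x] x] by (metis abs_ge_zero power2_abs power_mono)
    also have "\<dots> = ip (R x) (R x) * ip x x"
      using ip_nonneg x R(1)[OF x] by (simp add: power_mult_distrib)
    finally have "ip x x * (c\<^sup>2 * ip x x) \<le> ip x x * ip (R x) (R x)"
      by (simp add: power2_eq_square ac_simps)
    then show ?thesis
      using ip_nonneg[OF x] ip_nonneg[OF R(1)[OF x]] by (cases "ip x x = 0") auto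
  qed
  have upper: "ip (R x) (R x) \<le> C\<^sup>2 * ip x x" if x: "x \<in> F" for x
  proof -
    have "(ip (R x) (R x))\<^sup>2 \<le> (C * sqrt (ip (R x) (R x)) * sqrt (ip x x))\<^sup>2"
      using B_bdd[OF R(1)[OF x] x] R(2)[OF x R(1)[OF x]] by (metis abs_ge_zero power2_abs power_mono)
    also have "\<dots> = C\<^sup>2 * ip (R x) (R x) * ip x x"
      using ip_nonneg x R(1)[OF x] by (simp add: power_mult_distrib)
    finally have "ip (R x) (R x) * ip (R x) (R x) \<le> ip (R x) (R x) * (C\<^sup>2 * ip x x)"
      by (simp add: power2_eq_square ac_simps)
    then show ?thesis
      using ip_nonneg[OF x] ip_nonneg[OF R(1)[OF x]] by (cases "ip (R x) (R x) = 0") auto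
  qed
  interpret star: semi_inner_space F add scl "\<lambda>x y. ip (R x) (R y)"
  proof
    show "F \<noteq> {}" by (rule F_nonempty)
    show "ip (R x) (R y) = ip (R y) (R x)" if "x \<in> F" "y \<in> F" for x y
      by (intro ip_sym R that)
    show "0 \<le> ip (R x) (R x)" if "x \<in> F" for x
      by (intro ip_nonneg R that)
  qed (simp_all add: R add_closed scl_closed B_add_right B_scl_right)
  \<comment> \<open>\<open>lower\<close> turns a Cauchy sequence of the new seminorm into one of the
    old, and \<open>upper\<close> carries the limit back. Differences agree in both structures,
    since \<open>sub\<close> depends only on \<open>add\<close> and \<open>scl\<close>.\<close>
  interpret star: semi_hilbert_space F add scl "\<lambda>x y. ip (R x) (R y)"
  proof
    fix X :: "nat \<Rightarrow> 'a"
    assume X: "\<And>n. X n \<in> F"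
      and Cy: "\<And>e. e > 0 \<Longrightarrow> \<exists>N. \<forall>m\<ge>N. \<forall>n\<ge>N. ip (R (sub (X m) (X n))) (R (sub (X m) (X n))) < e"
    have "\<exists>x\<in>F. (\<lambda>n. ip (sub (X n) x) (sub (X n) x)) \<longlonglongrightarrow> 0"
    proof (rule complete_ip[OF X])
      fix e :: real assume e: "e > 0"
      then obtain N where N: "\<And>m n. m \<ge> N \<Longrightarrow> n \<ge> N \<Longrightarrow>
          ip (R (sub (X m) (X n))) (R (sub (X m) (X n))) < c\<^sup>2 * e"
        using Cy[of "c\<^sup>2 * e"] c by auto
      have "ip (sub (X m) (X n)) (sub (X m) (X n)) < e" if "m \<ge> N" "n \<ge> N" for m n
        using lower[OF sub_closed[OF X X], of m n] N[OF that] c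
        by (metis (no_types, lifting) le_less_trans mult_less_cancel_left_pos zero_less_power)
      then show "\<exists>N. \<forall>m\<ge>N. \<forall>n\<ge>N. ip (sub (X m) (X n)) (sub (X m) (X n)) < e" by blast
    qed
    then obtain x where x: "x \<in> F" "(\<lambda>n. ip (sub (X n) x) (sub (X n) x)) \<longlonglongrightarrow> 0" by blast
    have "(\<lambda>n. ip (R (sub (X n) x)) (R (sub (X n) x))) \<longlonglongrightarrow> 0"
    proof (rule Lim_null_comparison)
      show "\<forall>\<^sub>F n in sequentially. norm (ip (R (sub (X n) x)) (R (sub (X n) x)))
          \<le> C\<^sup>2 * ip (sub (X n) x) (sub (X n) x)"
        using upper sub_closed[OF X x(1)] R(1) by (simp add: ip_nonneg)
      show "(\<lambda>n. C\<^sup>2 * ip (sub (X n) x) (sub (X n) x)) \<longlonglongrightarrow> 0"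
        using tendsto_mult_right_zero[OF x(2)] by simp
    qed
    then show "\<exists>x\<in>F. (\<lambda>n. ip (R (sub (X n) x)) (R (sub (X n) x))) \<longlonglongrightarrow> 0"
      using x(1) by auto
  qed
  obtain w where w: "w \<in> F" "\<And>\<phi>. \<phi> \<in> F \<Longrightarrow> ip (R w) (R \<phi>) = ip l (R \<phi>)"
  proof -
    have "\<exists>w\<in>F. \<forall>\<phi>\<in>F. ip (R w) (R \<phi>) = ip l (R \<phi>)"
    proof (rule star.Riesz_representation)
      show "\<bar>ip l (R x)\<bar> \<le> sqrt (ip l l) * sqrt (ip (R x) (R x))" if "x \<in> F" for x
        by (intro Cauchy_Schwarz_ip l R that)
    qed (use R' l add_closed scl_closed B_add_right B_scl_right in auto)
    then show ?thesis using that by blast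
  qed
  define z where "z = sub (R w) l"
  have z: "z \<in> F" using w(1) l(1) R(1) by (simp add: z_def sub_closed)
  have "B z z = ip z (R z)" using R'[OF z z] by simp
  also have "\<dots> = ip (R w) (R z) - ip l (R z)"
    using ip_sub[OF R(1)[OF w(1)] l(1) R(1)[OF z]] by (simp only: z_def)
  also have "\<dots> = 0" using w(2)[OF z] by simp
  finally have z0: "ip z z = 0"
    using B_coer[OF z] ip_nonneg[OF z] c by (simp add: mult_le_0_iff)
  have "B \<phi> w = L \<phi>" if \<phi>: "\<phi> \<in> F" for \<phi>
  proof -
    have "ip z \<phi> = 0" using Cauchy_Schwarz_ip[OF z \<phi>] z0 by simp
    then show ?thesis using w(1) l R \<phi> by (simp add: z_def ip_sub)
  qed
  then show ?thesis using w(1) by blast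
qed

end

section \<open>Completeness of square-integrable functions\<close>

text \<open>The inequality is nonnegativity of the variance.\<close>

lemma (in prob_space) square_integral_le:
  fixes f :: "'a \<Rightarrow> real"
  assumes "f \<in> borel_measurable M" "integrable M (\<lambda>\<omega>. (f \<omega>)\<^sup>2)"
  shows "integrable M f" "(\<integral>\<omega>. f \<omega> \<partial>M)\<^sup>2 \<le> (\<integral>\<omega>. (f \<omega>)\<^sup>2 \<partial>M)"
proof -
  show i: "integrable M f" using square_integrable_imp_integrable[OF assms] .
  have "0 \<le> variance f" by simp
  then show "(\<integral>\<omega>. f \<omega> \<partial>M)\<^sup>2 \<le> (\<integral>\<omega>. (f \<omega>)\<^sup>2 \<partial>M)"
    using variance_eq[OF i assms(2)] by simp
qed

text \<open>Total mass 1 puts L2 inside L1 with constant 1. The bound on the mean later turns an L2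
  error between the exact and the discrete solution into an error of their expectations.\<close>

lemma L2_prob_integrable:
  fixes f :: "'a \<Rightarrow> 'b::{real_normed_vector,complete_space,second_countable_topology}"
  assumes P: "prob_space P" and f: "f \<in> L2 P norm S"
  shows "integrable P f" and "norm (\<integral>\<omega>. f \<omega> \<partial>P) \<le> L2norm P norm f"
    and "(\<integral>\<omega>. norm (f \<omega>) \<partial>P) \<le> L2norm P norm f"
proof -
  interpret prob_space P by (rule P)
  have [measurable]: "f \<in> borel_measurable P" using L2_measurable[OF f] .
  have n: "integrable P (\<lambda>\<omega>. norm (f \<omega>))"
    by (rule square_integral_le[OF _ L2_integrable[OF f]]) simp
  show i: "integrable P f" by (rule integrable_complete_space[OF _ n]) simp
  show le: "(\<integral>\<omega>. norm (f \<omega>) \<partial>P) \<le> L2norm P norm f"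
    unfolding L2norm_def by (intro real_le_rsqrt square_integral_le(2)[OF _ L2_integrable[OF f]]) simp
  have "ennreal (norm (\<integral>\<omega>. f \<omega> \<partial>P)) \<le> (\<integral>\<^sup>+\<omega>. ennreal (norm (f \<omega>)) \<partial>P)"
    by (rule integral_norm_bound_ennreal[OF i])
  also have "\<dots> = ennreal (\<integral>\<omega>. norm (f \<omega>) \<partial>P)"
    by (intro nn_integral_eq_integral n) simp
  finally have "norm (\<integral>\<omega>. f \<omega> \<partial>P) \<le> (\<integral>\<omega>. norm (f \<omega>) \<partial>P)"
    by (simp add: ennreal_le_iff)
  then show "norm (\<integral>\<omega>. f \<omega> \<partial>P) \<le> L2norm P norm f" using le by simp
qed

lemma semi_inner_space_L2:
  fixes P :: "'a measure"
  shows "semi_inner_space (L2 P norm (UNIV :: 'v::{real_inner,second_countable_topology} set))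
     (\<lambda>f g \<omega>. f \<omega> + g \<omega>) (\<lambda>r f \<omega>. r *\<^sub>R f \<omega>) (\<lambda>f g. \<integral>\<omega>. f \<omega> \<bullet> g \<omega> \<partial>P)"
proof
  have "(\<lambda>\<omega>. 0) \<in> L2 P norm (UNIV :: 'v set)" by (rule L2_I) auto
  then show "L2 P norm (UNIV :: 'v set) \<noteq> {}" by blast
  show "(\<integral>\<omega>. (x \<omega> + y \<omega>) \<bullet> z \<omega> \<partial>P) = (\<integral>\<omega>. x \<omega> \<bullet> z \<omega> \<partial>P) + (\<integral>\<omega>. y \<omega> \<bullet> z \<omega> \<partial>P)"
    if "x \<in> L2 P norm UNIV" "y \<in> L2 P norm UNIV" "z \<in> L2 P norm UNIV" for x y z :: "'a \<Rightarrow> 'v"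
    using that by (simp add: inner_add_left Bochner_Integration.integral_add L2_inner_integrable)
  show "(\<integral>\<omega>. x \<omega> \<bullet> y \<omega> \<partial>P) = (\<integral>\<omega>. y \<omega> \<bullet> x \<omega> \<partial>P)" for x y :: "'a \<Rightarrow> 'v"
    by (rule Bochner_Integration.integral_cong) (auto simp: inner_commute)
qed (erule (1) L2_add | erule L2_scaleR | simp)+

lemma L2norm_triangle:
  fixes f g :: "'a \<Rightarrow> 'b::{real_inner,second_countable_topology}"
  assumes f: "f \<in> L2 P norm S" and g: "g \<in> L2 P norm T"
  shows "L2norm P norm (\<lambda>\<omega>. f \<omega> + g \<omega>) \<le> L2norm P norm f + L2norm P norm g"
  using semi_inner_space.sqrt_ip_triangle[OF semi_inner_space_L2 L2_mono[OF f] L2_mono[OF g]]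
  by (simp add: L2norm_def dot_square_norm)

text \<open>Provides subsequences that converge at a prescribed speed. In \<open>r k\<close> the sum
  dominates the threshold \<open>N k\<close>, and the summand \<open>k\<close> keeps
  \<open>r\<close> strictly increasing even where thresholds vanish.\<close>

lemma Cauchy_modulus_subsequence:
  fixes d :: "nat \<Rightarrow> nat \<Rightarrow> real"
  assumes "\<And>e. e > 0 \<Longrightarrow> \<exists>N. \<forall>m\<ge>N. \<forall>n\<ge>N. d m n < e" and "\<And>k::nat. \<epsilon> k > 0"
  shows "\<exists>r. strict_mono r \<and> (\<forall>k. \<forall>m\<ge>r k. \<forall>n\<ge>r k. d m n < \<epsilon> k)"
proof -
  have "\<exists>N. \<forall>k. \<forall>m\<ge>N k. \<forall>n\<ge>N k. d m n < \<epsilon> k"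
    by (intro choice allI assms)
  then obtain N where N: "\<And>k m n. m \<ge> N k \<Longrightarrow> n \<ge> N k \<Longrightarrow> d m n < \<epsilon> k" by blast
  define r where "r k = k + (\<Sum>i\<le>k. N i)" for k :: nat
  have "strict_mono r" unfolding strict_mono_Suc_iff r_def by simp
  moreover have "N k \<le> r k" for k
  proof -
    have "N k \<le> (\<Sum>i\<le>k. N i)" by (rule member_le_sum) auto
    then show ?thesis by (simp add: r_def)
  qed
  ultimately show ?thesis using N by (meson order_trans)
qed

lemma Cauchy_if_summable_dist:
  fixes x :: "nat \<Rightarrow> 'b::real_normed_vector"
  assumes "summable (\<lambda>k. norm (x (Suc k) - x k))"
  shows "Cauchy x"
proof (rule metric_CauchyI)
  fix e :: real assume e: "e > 0"
  have step: "norm (x n - x m) \<le> (\<Sum>k\<in>{m..<n}. norm (x (Suc k) - x k))" if "m \<le> n" for m n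
    using norm_sum[of "\<lambda>k. x (Suc k) - x k" "{m..<n}"] sum_Suc_diff'[OF that, of x] by simp
  obtain N where N: "\<And>m n. m \<ge> N \<Longrightarrow> norm (\<Sum>k\<in>{m..<n}. norm (x (Suc k) - x k)) < e"
    using assms e unfolding summable_Cauchy by blast
  have "dist (x m) (x n) < e" if "m \<ge> N" "n \<ge> N" "m \<le> n" for m n
    using step[OF that(3)] N[OF that(1), of n] by (simp add: dist_norm norm_minus_commute)
  then show "\<exists>N. \<forall>m\<ge>N. \<forall>n\<ge>N. dist (x m) (x n) < e"
    by (metis dist_commute nle_le)
qed

text \<open>Riesz-Fischer: the increments of a fast subsequence are summable in L1, hence almost
  everywhere, which yields a pointwise limit. Fatou's lemma then turns the Cauchy bound into
  convergence in L2.\<close>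

theorem L2_complete:
  fixes X :: "nat \<Rightarrow> 'a \<Rightarrow> 'b::{real_normed_vector,complete_space,second_countable_topology}"
  assumes P: "prob_space P" and X: "\<And>n. X n \<in> L2 P norm UNIV"
    and Cy: "\<And>e. e > 0 \<Longrightarrow> \<exists>N. \<forall>m\<ge>N. \<forall>n\<ge>N. (\<integral>\<omega>. (norm (X m \<omega> - X n \<omega>))\<^sup>2 \<partial>P) < e"
  shows "\<exists>f\<in>L2 P norm UNIV. (\<lambda>n. \<integral>\<omega>. (norm (X n \<omega> - f \<omega>))\<^sup>2 \<partial>P) \<longlonglongrightarrow> 0"
proof -
  interpret prob_space P by (rule P)
  have Xm[measurable]: "X n \<in> borel_measurable P" for n using L2_measurable[OF X] .
  have D: "(\<lambda>\<omega>. X m \<omega> - X n \<omega>) \<in> L2 P norm UNIV" for m n by (rule L2_diff[OF X X])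
  \<comment> \<open>The Cauchy hypothesis concerns squared norms, so the tolerance is the square of
    \<open>(1/2)^k\<close>; the norms of the increments are then dominated by a geometric
    series.\<close>
  obtain r where r: "strict_mono r" and
    rd: "\<And>k m n. m \<ge> r k \<Longrightarrow> n \<ge> r k \<Longrightarrow> (\<integral>\<omega>. (norm (X m \<omega> - X n \<omega>))\<^sup>2 \<partial>P) < ((1/2)^k)\<^sup>2"
    using Cauchy_modulus_subsequence[OF Cy, of "\<lambda>k. ((1/2)^k)\<^sup>2"] by auto
  define Y where "Y k = X (r k)" for k
  have [measurable]: "Y k \<in> borel_measurable P" for k by (simp add: Y_def)
  have Ybd: "(\<integral>\<^sup>+\<omega>. ennreal (norm (Y (Suc k) \<omega> - Y k \<omega>)) \<partial>P) \<le> ennreal ((1/2)^k)" for k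
  proof -
    have D': "(\<lambda>\<omega>. Y (Suc k) \<omega> - Y k \<omega>) \<in> L2 P norm UNIV" unfolding Y_def by (rule D)
    have "(\<integral>\<^sup>+\<omega>. ennreal (norm (Y (Suc k) \<omega> - Y k \<omega>)) \<partial>P) = ennreal (\<integral>\<omega>. norm (Y (Suc k) \<omega> - Y k \<omega>) \<partial>P)"
      by (intro nn_integral_eq_integral square_integral_le(1)[OF _ L2_integrable[OF D']]) auto
    moreover have "(\<integral>\<omega>. norm (Y (Suc k) \<omega> - Y k \<omega>) \<partial>P) \<le> L2norm P norm (\<lambda>\<omega>. Y (Suc k) \<omega> - Y k \<omega>)"
      by (rule L2_prob_integrable(3)[OF P D'])
    moreover have "\<dots> \<le> (1/2)^k"
      unfolding L2norm_def Y_def using rd[where k1=k and m1="r (Suc k)" and n1="r k"] r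
      by (intro real_le_lsqrt) (auto simp: strict_mono_leD less_imp_le)
    ultimately show ?thesis by (simp add: ennreal_leI)
  qed
  have "(\<integral>\<^sup>+\<omega>. (\<Sum>k. ennreal (norm (Y (Suc k) \<omega> - Y k \<omega>))) \<partial>P)
      = (\<Sum>k. \<integral>\<^sup>+\<omega>. ennreal (norm (Y (Suc k) \<omega> - Y k \<omega>)) \<partial>P)"
    by (rule nn_integral_suminf) simp
  also have "\<dots> \<le> (\<Sum>k. ennreal ((1/2)^k))" by (intro suminf_le Ybd) auto
  also have "\<dots> = ennreal (\<Sum>k. (1/2)^k)" by (intro suminf_ennreal2) auto
  also have "\<dots> < \<infinity>" by simp
  finally have "AE \<omega> in P. (\<Sum>k. ennreal (norm (Y (Suc k) \<omega> - Y k \<omega>))) \<noteq> \<infinity>"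
    by (intro nn_integral_PInf_AE) auto
  then have AEC: "AE \<omega> in P. Cauchy (\<lambda>k. Y k \<omega>)"
  proof eventually_elim
    case (elim \<omega>)
    then show ?case
      by (intro Cauchy_if_summable_dist summable_suminf_not_top) auto
  qed
  have Cm[measurable]: "Measurable.pred P (\<lambda>\<omega>. Cauchy (\<lambda>k. Y k \<omega>))"
    unfolding metric_Cauchy_iff2 by measurable
  \<comment> \<open>The value 0 off the convergence set makes \<open>f\<close> an everywhere limit
    of measurable functions; the set is measurable because being Cauchy is a countable
    condition.\<close>
  define f where "f \<omega> = (if Cauchy (\<lambda>k. Y k \<omega>) then lim (\<lambda>k. Y k \<omega>) else 0)" for \<omega>
  have fm[measurable]: "f \<in> borel_measurable P"
  proof (rule borel_measurable_LIMSEQ_metric)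
    show "(\<lambda>\<omega>. if Cauchy (\<lambda>k. Y k \<omega>) then Y i \<omega> else 0) \<in> borel_measurable P" for i
      by measurable
    show "(\<lambda>i. if Cauchy (\<lambda>k. Y k \<omega>) then Y i \<omega> else 0) \<longlonglongrightarrow> f \<omega>" for \<omega>
      by (auto simp: f_def convergent_LIMSEQ_iff[symmetric] Cauchy_convergent)
  qed
  have lim: "AE \<omega> in P. (\<lambda>k. Y k \<omega>) \<longlonglongrightarrow> f \<omega>"
    using AEC by eventually_elim (auto simp: f_def convergent_LIMSEQ_iff[symmetric] Cauchy_convergent)
  \<comment> \<open>Fatou along the subsequence bounds the distance to \<open>f\<close> for every
    \<open>X n\<close> with \<open>n \<ge> r k\<close>, so the full sequence converges.\<close>
  have est: "integrable P (\<lambda>\<omega>. (norm (X n \<omega> - f \<omega>))\<^sup>2) \<and> (\<integral>\<omega>. (norm (X n \<omega> - f \<omega>))\<^sup>2 \<partial>P) \<le> ((1/2)^k)\<^sup>2"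
    if n: "n \<ge> r k" for n k
  proof -
    have "(\<integral>\<^sup>+\<omega>. ennreal ((norm (X n \<omega> - f \<omega>))\<^sup>2) \<partial>P)
        = (\<integral>\<^sup>+\<omega>. liminf (\<lambda>j. ennreal ((norm (X n \<omega> - Y j \<omega>))\<^sup>2)) \<partial>P)"
    proof (rule nn_integral_cong_AE)
      show "AE \<omega> in P. ennreal ((norm (X n \<omega> - f \<omega>))\<^sup>2) = liminf (\<lambda>j. ennreal ((norm (X n \<omega> - Y j \<omega>))\<^sup>2))"
        using lim
      proof eventually_elim
        case (elim \<omega>)
        have "(\<lambda>j. ennreal ((norm (X n \<omega> - Y j \<omega>))\<^sup>2)) \<longlonglongrightarrow> ennreal ((norm (X n \<omega> - f \<omega>))\<^sup>2)"
          by (intro tendsto_ennrealI tendsto_intros elim)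
        then show ?case by (rule lim_imp_Liminf[symmetric, OF sequentially_bot])
      qed
    qed
    also have "\<dots> \<le> liminf (\<lambda>j. \<integral>\<^sup>+\<omega>. ennreal ((norm (X n \<omega> - Y j \<omega>))\<^sup>2) \<partial>P)"
      by (intro nn_integral_liminf) simp
    also have "\<dots> \<le> ennreal (((1/2)^k)\<^sup>2)"
    proof (rule Liminf_le)
      show "\<forall>\<^sub>F j in sequentially. (\<integral>\<^sup>+\<omega>. ennreal ((norm (X n \<omega> - Y j \<omega>))\<^sup>2) \<partial>P) \<le> ennreal (((1/2)^k)\<^sup>2)"
      proof (rule eventually_sequentiallyI[of k])
        fix j assume "j \<ge> k"
        then have "r j \<ge> r k" using r by (simp add: strict_mono_leD)
        then have "(\<integral>\<omega>. (norm (X n \<omega> - Y j \<omega>))\<^sup>2 \<partial>P) \<le> ((1/2)^k)\<^sup>2"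
          using rd[OF n] unfolding Y_def by (simp add: less_imp_le)
        moreover have "(\<integral>\<^sup>+\<omega>. ennreal ((norm (X n \<omega> - Y j \<omega>))\<^sup>2) \<partial>P) = ennreal (\<integral>\<omega>. (norm (X n \<omega> - Y j \<omega>))\<^sup>2 \<partial>P)"
          unfolding Y_def by (intro nn_integral_eq_integral L2_integrable[OF D]) simp
        ultimately show "(\<integral>\<^sup>+\<omega>. ennreal ((norm (X n \<omega> - Y j \<omega>))\<^sup>2) \<partial>P) \<le> ennreal (((1/2)^k)\<^sup>2)"
          by (simp add: ennreal_leI)
      qed
    qed simp
    finally have nn: "(\<integral>\<^sup>+\<omega>. ennreal ((norm (X n \<omega> - f \<omega>))\<^sup>2) \<partial>P) \<le> ennreal (((1/2)^k)\<^sup>2)" .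
    have int: "integrable P (\<lambda>\<omega>. (norm (X n \<omega> - f \<omega>))\<^sup>2)"
      using nn by (intro integrableI_bounded) (auto intro: le_less_trans)
    have "(\<integral>\<^sup>+\<omega>. ennreal ((norm (X n \<omega> - f \<omega>))\<^sup>2) \<partial>P) = ennreal (\<integral>\<omega>. (norm (X n \<omega> - f \<omega>))\<^sup>2 \<partial>P)"
      by (intro nn_integral_eq_integral int) simp
    with nn int show ?thesis by (simp add: ennreal_le_iff)
  qed
  have "(\<lambda>\<omega>. X (r 0) \<omega> - f \<omega>) \<in> L2 P norm UNIV"
    using est[of 0 "r 0"] by (intro L2_I) auto
  from L2_diff[OF X[of "r 0"] this] have "f \<in> L2 P norm UNIV" by simp
  moreover have "(\<lambda>n. \<integral>\<omega>. (norm (X n \<omega> - f \<omega>))\<^sup>2 \<partial>P) \<longlonglongrightarrow> 0"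
  proof (rule LIMSEQ_I)
    fix e :: real assume "e > 0"
    then obtain k where k: "(1/4)^k < e" using real_arch_pow_inv[of e "1/4"] by auto
    have "((1/2::real)^k)\<^sup>2 = (1/4)^k" by (simp add: power_mult_distrib[symmetric] power2_eq_square)
    then have "norm ((\<integral>\<omega>. (norm (X n \<omega> - f \<omega>))\<^sup>2 \<partial>P) - 0) < e" if "n \<ge> r k" for n
      using est[OF that] k by simp
    then show "\<exists>N. \<forall>n\<ge>N. norm ((\<integral>\<omega>. (norm (X n \<omega> - f \<omega>))\<^sup>2 \<partial>P) - 0) < e" by blast
  qed
  ultimately show ?thesis by blast
qed

lemma semi_hilbert_space_L2:
  fixes P :: "'a measure"
  assumes P: "prob_space P"
  shows "semi_hilbert_space (L2 P norm (UNIV :: 'v::{real_inner,complete_space,second_countable_topology} set))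
     (\<lambda>f g \<omega>. f \<omega> + g \<omega>) (\<lambda>r f \<omega>. r *\<^sub>R f \<omega>) (\<lambda>f g. \<integral>\<omega>. f \<omega> \<bullet> g \<omega> \<partial>P)"
proof -
  interpret semi_inner_space "L2 P norm (UNIV :: 'v set)"
     "\<lambda>f g \<omega>. f \<omega> + g \<omega>" "\<lambda>r f \<omega>. r *\<^sub>R f \<omega>" "\<lambda>f g. \<integral>\<omega>. f \<omega> \<bullet> g \<omega> \<partial>P"
    by (rule semi_inner_space_L2)
  show ?thesis
  proof
    fix X :: "nat \<Rightarrow> 'a \<Rightarrow> 'v"
    assume X: "\<And>n. X n \<in> L2 P norm UNIV"
      and Cy: "\<And>e. e > 0 \<Longrightarrow> \<exists>N. \<forall>m\<ge>N. \<forall>n\<ge>N.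
        (\<integral>\<omega>. sub (X m) (X n) \<omega> \<bullet> sub (X m) (X n) \<omega> \<partial>P) < e"
    have sq: "sub f g \<omega> \<bullet> sub f g \<omega> = (norm (f \<omega> - g \<omega>))\<^sup>2" for f g \<omega>
      by (simp add: sub_def dot_square_norm)
    show "\<exists>x\<in>L2 P norm UNIV. (\<lambda>n. \<integral>\<omega>. sub (X n) x \<omega> \<bullet> sub (X n) x \<omega> \<partial>P) \<longlonglongrightarrow> 0"
      unfolding sq by (rule L2_complete[OF P X Cy[unfolded sq]])
  qed
qed

text \<open>The unknown stands in the second argument because only the dual problem has to be
  solved; \<open>u\<close> and \<open>U h\<close> are given.\<close>

theorem Lax_Milgram_L2:
  fixes P :: "'a measure"
    and B :: "('a \<Rightarrow> 'v::{real_inner,complete_space,second_countable_topology}) \<Rightarrow> ('a \<Rightarrow> 'v) \<Rightarrow> real"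
  assumes P: "prob_space P" and bil: "fun_bilinear_on (L2 P norm UNIV) B"
    and bdd: "\<And>x y. x \<in> L2 P norm UNIV \<Longrightarrow> y \<in> L2 P norm UNIV
        \<Longrightarrow> \<bar>B x y\<bar> \<le> C * L2norm P norm x * L2norm P norm y"
    and c: "c > 0" and coer: "\<And>x. x \<in> L2 P norm UNIV \<Longrightarrow> c * (L2norm P norm x)\<^sup>2 \<le> B x x"
    and L: "fun_linear_on (L2 P norm UNIV) L"
    and L_bdd: "\<And>x. x \<in> L2 P norm UNIV \<Longrightarrow> \<bar>L x\<bar> \<le> K * L2norm P norm x"
  shows "\<exists>w\<in>L2 P norm UNIV. \<forall>\<phi>\<in>L2 P norm UNIV. B \<phi> w = L \<phi>"
proof (rule semi_hilbert_space.Lax_Milgram[OF semi_hilbert_space_L2[OF P], where C=C and c=c and K=K])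
  note b = bil[unfolded fun_bilinear_on_def] and l = L[unfolded fun_linear_on_def]
  show "B (\<lambda>\<omega>. x \<omega> + y \<omega>) z = B x z + B y z" "B z (\<lambda>\<omega>. x \<omega> + y \<omega>) = B z x + B z y"
    if "x \<in> L2 P norm UNIV" "y \<in> L2 P norm UNIV" "z \<in> L2 P norm UNIV" for x y z
    using b that by blast+
  show "B (\<lambda>\<omega>. r *\<^sub>R x \<omega>) y = r * B x y" "B x (\<lambda>\<omega>. r *\<^sub>R y \<omega>) = r * B x y"
    if "x \<in> L2 P norm UNIV" "y \<in> L2 P norm UNIV" for r x y
    using b that by blast+
  show "L (\<lambda>\<omega>. x \<omega> + y \<omega>) = L x + L y"
    if "x \<in> L2 P norm UNIV" "y \<in> L2 P norm UNIV" for x y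
    using l that by blast
  show "L (\<lambda>\<omega>. r *\<^sub>R x \<omega>) = r * L x" if "x \<in> L2 P norm UNIV" for r x
    using l that by blast
  show "\<bar>B x y\<bar> \<le> C * sqrt (\<integral>\<omega>. x \<omega> \<bullet> x \<omega> \<partial>P) * sqrt (\<integral>\<omega>. y \<omega> \<bullet> y \<omega> \<partial>P)"
    if "x \<in> L2 P norm UNIV" "y \<in> L2 P norm UNIV" for x y
    using bdd[OF that] by (simp add: L2norm_def dot_square_norm)
  show "c * (\<integral>\<omega>. x \<omega> \<bullet> x \<omega> \<partial>P) \<le> B x x" if "x \<in> L2 P norm UNIV" for x
    using coer[OF that] by (simp add: L2norm_def dot_square_norm)
  show "\<bar>L x\<bar> \<le> K * sqrt (\<integral>\<omega>. x \<omega> \<bullet> x \<omega> \<partial>P)" if "x \<in> L2 P norm UNIV" for x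
    using L_bdd[OF that] by (simp add: L2norm_def dot_square_norm)
qed (rule c)

section \<open>Finite-dimensional subspaces\<close>

text \<open>For \<open>k \<noteq> 0\<close> the vector \<open>x / k\<close> differs from
  \<open>b\<close> by an element of \<open>span B\<close>, so its norm is at least
  \<open>d\<close>.\<close>

lemma coefficient_bound:
  fixes b :: "'d::real_normed_vector"
  assumes d: "\<And>y. y \<in> span B \<Longrightarrow> d \<le> norm (b - y)" and x: "x - k *\<^sub>R b \<in> span B"
  shows "\<bar>k\<bar> * d \<le> norm x"
proof (cases "k = 0")
  case False
  have "d \<le> norm (b - (- 1 / k) *\<^sub>R (x - k *\<^sub>R b))" by (intro d span_mul x)
  also have "b - (- 1 / k) *\<^sub>R (x - k *\<^sub>R b) = (1 / k) *\<^sub>R x"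
    using False by (simp add: algebra_simps)
  finally show ?thesis using False by (simp add: field_simps)
qed simp

text \<open>At distance 0, points of the span would converge to \<open>b\<close>, and completeness
  would place \<open>b\<close> in the span. Completeness is a hypothesis because the lemma serves
  inside the induction that proves it.\<close>

lemma span_dist_pos_if_complete:
  fixes b :: "'d::real_normed_vector"
  assumes "\<And>X. Cauchy X \<Longrightarrow> (\<And>n. X n \<in> span B) \<Longrightarrow> \<exists>x\<in>span B. X \<longlonglongrightarrow> x" and b: "b \<notin> span B"
  shows "\<exists>d>0. \<forall>y\<in>span B. d \<le> norm (b - y)"
proof (rule ccontr)
  assume "\<not> ?thesis"
  then have "\<exists>y\<in>span B. norm (b - y) < 1 / real (Suc n)" for n
    by (metis not_le of_nat_0_less_iff zero_less_Suc zero_less_divide_1_iff)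
  then obtain y where y: "\<And>n. y n \<in> span B" "\<And>n. norm (b - y n) < 1 / real (Suc n)" by metis
  have "y \<longlonglongrightarrow> b"
  proof (rule LIM_zero_cancel, rule Lim_null_comparison)
    show "\<forall>\<^sub>F n in sequentially. norm (y n - b) \<le> 1 / real (Suc n)"
      using y(2) by (intro always_eventually allI) (simp add: norm_minus_commute less_imp_le)
    show "(\<lambda>n. 1 / real (Suc n)) \<longlonglongrightarrow> 0"
      using LIMSEQ_inverse_real_of_nat by (simp add: inverse_eq_divide)
  qed
  moreover obtain x where "x \<in> span B" "y \<longlonglongrightarrow> x"
    using assms(1)[OF LIMSEQ_imp_Cauchy[OF calculation] y(1)] by blast
  ultimately show False using LIMSEQ_unique b by blast
qed

lemma Cauchy_diff:
  fixes X Y :: "nat \<Rightarrow> 'd::real_normed_vector"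
  assumes "Cauchy X" "Cauchy Y"
  shows "Cauchy (\<lambda>n. X n - Y n)"
proof (rule CauchyI)
  fix e :: real assume "e > 0"
  then have "e / 2 > 0" by simp
  then obtain M N where M: "\<And>m n. m \<ge> M \<Longrightarrow> n \<ge> M \<Longrightarrow> norm (X m - X n) < e / 2"
    and N: "\<And>m n. m \<ge> N \<Longrightarrow> n \<ge> N \<Longrightarrow> norm (Y m - Y n) < e / 2"
    using CauchyD[OF assms(1)] CauchyD[OF assms(2)] by metis
  have "norm ((X m - Y m) - (X n - Y n)) < e" if "m \<ge> max M N" "n \<ge> max M N" for m n
    using norm_triangle_ineq4[of "X m - X n" "Y m - Y n"] M[of m n] N[of m n] that
    by (simp add: algebra_simps)
  then show "\<exists>M. \<forall>m\<ge>M. \<forall>n\<ge>M. norm ((X m - Y m) - (X n - Y n)) < e" by blast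
qed

text \<open>\<open>'d\<close> carries no completeness of its own. For \<open>b\<close> outside
  \<open>span B\<close> the positive distance to \<open>span B\<close> controls the coefficient of
  \<open>b\<close>, so a Cauchy sequence splits into a Cauchy sequence of scalars and one in
  \<open>span B\<close>.\<close>

lemma finite_span_complete:
  fixes B :: "'d::real_normed_vector set"
  assumes "finite B" "Cauchy X" "\<And>n. X n \<in> span B"
  shows "\<exists>x\<in>span B. X \<longlonglongrightarrow> x"
  using assms
proof (induction B arbitrary: X rule: finite_induct)
  case empty
  then have "X = (\<lambda>_. 0)" by auto
  then show ?case by auto
next
  case (insert b B)
  show ?case
  proof (cases "b \<in> span B")
    case True
    then show ?thesis using insert by (simp add: span_redundant)
  next
    case False
    obtain d where d: "d > 0" "\<And>y. y \<in> span B \<Longrightarrow> d \<le> norm (b - y)"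
      using span_dist_pos_if_complete[OF insert.IH False] by blast
    have "\<exists>k. X n - k *\<^sub>R b \<in> span B" for n
      using insert.prems(2)[of n] by (simp add: span_insert)
    then obtain k where k: "\<And>n. X n - k n *\<^sub>R b \<in> span B" by metis
    have kd: "\<bar>k m - k n\<bar> * d \<le> norm (X m - X n)" for m n
    proof (rule coefficient_bound[OF d(2)])
      show "X m - X n - (k m - k n) *\<^sub>R b \<in> span B"
        using span_diff[OF k[of m] k[of n]] by (simp add: algebra_simps)
    qed
    have "Cauchy k"
    proof (rule metric_CauchyI)
      fix e :: real assume "e > 0"
      then obtain N where N: "\<And>m n. m \<ge> N \<Longrightarrow> n \<ge> N \<Longrightarrow> norm (X m - X n) < e * d"
        using CauchyD[OF insert.prems(1), of "e * d"] d by auto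
      have "dist (k m) (k n) < e" if "m \<ge> N" "n \<ge> N" for m n
        using le_less_trans[OF kd N[OF that]] d(1) by (simp add: dist_real_def)
      then show "\<exists>N. \<forall>m\<ge>N. \<forall>n\<ge>N. dist (k m) (k n) < e" by blast
    qed
    then obtain k0 where k0: "k \<longlonglongrightarrow> k0" using Cauchy_convergent convergent_def by blast
    have kb: "(\<lambda>n. k n *\<^sub>R b) \<longlonglongrightarrow> k0 *\<^sub>R b" by (intro tendsto_intros k0)
    obtain y where y: "y \<in> span B" "(\<lambda>n. X n - k n *\<^sub>R b) \<longlonglongrightarrow> y"
      using insert.IH[OF Cauchy_diff[OF insert.prems(1) LIMSEQ_imp_Cauchy[OF kb]] k] by blast
    have "X \<longlonglongrightarrow> y + k0 *\<^sub>R b" using tendsto_add[OF y(2) kb] by simp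
    moreover have "y + k0 *\<^sub>R b \<in> span (insert b B)"
      using y(1) by (auto simp: span_insert intro!: exI[of _ k0])
    ultimately show ?thesis by blast
  qed
qed

lemma linear_on_diff:
  assumes "linear_on S f" "subspace S" "x \<in> S" "y \<in> S"
  shows "f (x - y) = f x - f y"
proof -
  have "f (x + (-1) *\<^sub>R y) = f x + (-1) *\<^sub>R f y"
    using assms subspace_scale[OF assms(2,4), of "-1"] unfolding linear_on_def by metis
  then show ?thesis by simp
qed

lemma linear_on_0: "linear_on S f \<Longrightarrow> x \<in> S \<Longrightarrow> f 0 = 0"
  unfolding linear_on_def by (metis scale_zero_left)

text \<open>The same splitting: the coefficient of the new vector is at most
  \<open>norm x / d\<close>. This supplies bounds in the norm of \<open>'d\<close> for maps such as
  the lift, which are bounded by hypothesis only in the discrete norms.\<close>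

theorem linear_on_finite_span_bounded:
  fixes f :: "'d::real_normed_vector \<Rightarrow> 'e::real_normed_vector"
  assumes "finite B" "linear_on (span B) f"
  shows "\<exists>K\<ge>0. \<forall>x\<in>span B. norm (f x) \<le> K * norm x"
  using assms
proof (induction B rule: finite_induct)
  case empty
  then show ?case using linear_on_0[OF empty span_zero] by auto
next
  case (insert b B)
  show ?case
  proof (cases "b \<in> span B")
    case True
    then show ?thesis using insert by (simp add: span_redundant)
  next
    case False
    have sub: "span B \<subseteq> span (insert b B)" by (intro span_mono) auto
    obtain d where d: "d > 0" "\<And>y. y \<in> span B \<Longrightarrow> d \<le> norm (b - y)"
      using span_dist_pos_if_complete[OF finite_span_complete[OF insert.hyps(1)] False] by blast
    have "linear_on (span B) f" using insert.prems sub unfolding linear_on_def by blast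
    then obtain K where K: "K \<ge> 0" "\<And>x. x \<in> span B \<Longrightarrow> norm (f x) \<le> K * norm x"
      using insert.IH by blast
    have "norm (f x) \<le> (K * (1 + norm b / d) + norm (f b) / d) * norm x" if x: "x \<in> span (insert b B)" for x
    proof -
      obtain k where k: "x - k *\<^sub>R b \<in> span B" using x by (auto simp: span_insert)
      have kd: "\<bar>k\<bar> \<le> norm x / d"
        using coefficient_bound[OF d(2) k] d(1) by (simp add: field_simps)
      have bb: "b \<in> span (insert b B)" by (intro span_base) simp
      have "f x = f ((x - k *\<^sub>R b) + k *\<^sub>R b)" by simp
      also have "\<dots> = f (x - k *\<^sub>R b) + k *\<^sub>R f b"
        using insert.prems sub k bb span_mul[OF bb] unfolding linear_on_def by (metis subsetD)
      finally have "norm (f x) \<le> norm (f (x - k *\<^sub>R b)) + \<bar>k\<bar> * norm (f b)"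
        using norm_triangle_ineq[of "f (x - k *\<^sub>R b)" "k *\<^sub>R f b"] by simp
      also have "\<dots> \<le> K * (norm x + \<bar>k\<bar> * norm b) + \<bar>k\<bar> * norm (f b)"
        using K(2)[OF k] mult_left_mono[OF norm_triangle_ineq4[of x "k *\<^sub>R b"] K(1)] by simp
      also have "\<dots> \<le> K * (norm x + norm x / d * norm b) + norm x / d * norm (f b)"
        by (intro add_mono mult_left_mono mult_right_mono kd K order_refl) auto
      also have "\<dots> = (K * (1 + norm b / d) + norm (f b) / d) * norm x" by (simp add: algebra_simps)
      finally show ?thesis .
    qed
    moreover have "0 \<le> K * (1 + norm b / d) + norm (f b) / d" using K(1) d(1) by simp
    ultimately show ?thesis by blast
  qed
qed

text \<open>A bounded linear map is Lipschitz on the span, hence Borel there. Nothing is known about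
  \<open>f\<close> elsewhere, so \<open>X\<close> is viewed as a map into the restricted Borel
  space.\<close>

lemma linear_on_finite_span_measurable:
  fixes f :: "'d::real_normed_vector \<Rightarrow> 'e::real_normed_vector"
  assumes B: "finite B" and f: "linear_on (span B) f"
    and X: "X \<in> borel_measurable P" "\<And>\<omega>. \<omega> \<in> space P \<Longrightarrow> X \<omega> \<in> span B"
  shows "(\<lambda>\<omega>. f (X \<omega>)) \<in> borel_measurable P"
proof -
  obtain K where K: "K \<ge> 0" "\<And>x. x \<in> span B \<Longrightarrow> norm (f x) \<le> K * norm x"
    using linear_on_finite_span_bounded[OF B f] by blast
  have "K-lipschitz_on (span B) f"
  proof (rule lipschitz_onI)
    show "dist (f x) (f y) \<le> K * dist x y" if "x \<in> span B" "y \<in> span B" for x y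
      using K(2)[OF span_diff[OF that]] linear_on_diff[OF f subspace_span that] by (simp add: dist_norm)
  qed (rule K)
  then have "continuous_on (span B) f" by (rule lipschitz_on_continuous_on)
  then have "f \<in> borel_measurable (restrict_space borel (span B))"
    by (rule borel_measurable_continuous_on_restrict)
  moreover have "X \<in> P \<rightarrow>\<^sub>M restrict_space borel (span B)"
    using X by (intro measurable_restrict_space2) auto
  ultimately show ?thesis by (rule measurable_compose[rotated])
qed

text \<open>One Gram-Schmidt step per vector. The point is that \<open>Q\<close> is a bounded linear
  map on the whole space, so that applying it pathwise preserves measurability.\<close>

theorem orthogonal_projection_finite_span:
  fixes B :: "'v::real_inner set"
  assumes "finite B"
  shows "\<exists>Q. bounded_linear Q \<and> (\<forall>x. Q x \<in> span B) \<and> (\<forall>x. \<forall>y\<in>span B. (x - Q x) \<bullet> y = 0)"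
  using assms
proof (induction B rule: finite_induct)
  case empty
  show ?case by (intro exI[of _ "\<lambda>_. 0"]) auto
next
  case (insert b B)
  then obtain Q where Q: "bounded_linear Q" "\<And>x. Q x \<in> span B" "\<And>x y. y \<in> span B \<Longrightarrow> (x - Q x) \<bullet> y = 0"
    by blast
  define e where "e = b - Q b"
  have sub: "span B \<subseteq> span (insert b B)" by (intro span_mono) auto
  have e: "e \<in> span (insert b B)" unfolding e_def
    using Q(2)[of b] sub span_base[of b "insert b B"] by (intro span_diff) auto
  \<comment> \<open>If \<open>b\<close> already lies in \<open>span B\<close>, then
    \<open>e = 0\<close> and the quotient is 0 by the convention for division by zero, so
    \<open>Q'\<close> coincides with \<open>Q\<close>.\<close>
  define Q' where "Q' x = Q x + ((x \<bullet> e) / (e \<bullet> e)) *\<^sub>R e" for x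
  have "bounded_linear Q'" unfolding Q'_def
    by (intro bounded_linear_add Q bounded_linear_scaleR_const bounded_linear_divide[THEN bounded_linear_compose]
        bounded_linear_inner_left)
  moreover have "Q' x \<in> span (insert b B)" for x
    unfolding Q'_def using Q(2) sub e by (intro span_add span_mul) auto
  moreover have "(x - Q' x) \<bullet> y = 0" if y: "y \<in> span (insert b B)" for x y
  proof -
    obtain k where k: "y - k *\<^sub>R b \<in> span B" using y by (auto simp: span_insert)
    \<comment> \<open>Taken along \<open>e\<close> instead of \<open>b\<close>, \<open>y\<close> is
      the sum of \<open>z\<close> in \<open>span B\<close> and a multiple of \<open>e\<close>; it
      suffices that \<open>x - Q' x\<close> is orthogonal to both.\<close>
    define z where "z = y - k *\<^sub>R e"
    have "z = (y - k *\<^sub>R b) + k *\<^sub>R Q b" by (simp add: z_def e_def algebra_simps)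
    then have z: "z \<in> span B" using k Q(2) by (simp add: span_add span_mul)
    have ez: "e \<bullet> z = 0" unfolding e_def using Q(3)[OF z] .
    have eQ: "Q x \<bullet> e = 0" unfolding e_def using Q(3)[OF Q(2)] by (simp add: inner_commute)
    have "(x - Q' x) \<bullet> z = 0"
      using Q(3)[OF z, of x] ez by (simp add: Q'_def inner_diff_left inner_add_left)
    moreover have "(x - Q' x) \<bullet> e = 0"
      using eQ by (cases "e = 0") (simp_all add: Q'_def inner_diff_left inner_add_left)
    moreover have "y = z + k *\<^sub>R e" by (simp add: z_def)
    ultimately show ?thesis by (simp add: inner_add_right)
  qed
  ultimately show ?case by blast
qed

text \<open>Pythagoras for \<open>x - q\<close> and \<open>q - y\<close>; the first bound is the
  case \<open>y = 0\<close>. The second lets the projection inherit the approximation order of any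
  other map into \<open>S\<close>, such as \<open>Ih\<close>.\<close>

lemma orthogonal_projection_norms:
  fixes x :: "'v::real_inner"
  assumes q: "q \<in> S" "\<And>y. y \<in> S \<Longrightarrow> (x - q) \<bullet> y = 0" and S: "subspace S"
  shows "norm q \<le> norm x" and "y \<in> S \<Longrightarrow> norm (x - q) \<le> norm (x - y)"
proof -
  have pyth: "(norm (x - y))\<^sup>2 = (norm (x - q))\<^sup>2 + (norm (q - y))\<^sup>2" if "y \<in> S" for y
    using q(2)[OF subspace_diff[OF S q(1) that]] norm_add_Pythagorean[of "x - q" "q - y"]
    by (simp add: orthogonal_def)
  have "(norm q)\<^sup>2 \<le> (norm x)\<^sup>2" using pyth[OF subspace_0[OF S]] by simp
  then show "norm q \<le> norm x" by (rule power2_le_imp_le) simp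
  show "norm (x - q) \<le> norm (x - y)" if "y \<in> S"
    using pyth[OF that] by (intro power2_le_imp_le[of "norm (x - q)"]) auto
qed

section \<open>Monte Carlo sampling\<close>

lemma L2_const:
  assumes "finite_measure M"
  shows "(\<lambda>_. c :: 'b::{real_normed_vector,second_countable_topology}) \<in> L2 M norm UNIV"
  by (rule L2_I) (simp_all add: finite_measure.integrable_const[OF assms])

lemma L2_sum:
  fixes f :: "'i \<Rightarrow> 'a \<Rightarrow> 'b::{real_normed_vector,second_countable_topology}"
  assumes "finite I" "\<And>i. i \<in> I \<Longrightarrow> f i \<in> L2 P norm UNIV"
  shows "(\<lambda>\<omega>. \<Sum>i\<in>I. f i \<omega>) \<in> L2 P norm UNIV"
  using assms
proof (induction I rule: finite_induct)
  case empty
  show ?case by (rule L2_I) auto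
next
  case (insert i I)
  then show ?case using L2_add[of "f i" P UNIV "\<lambda>\<omega>. \<Sum>i\<in>I. f i \<omega>" UNIV] by simp
qed

lemma L2_PiM_component:
  fixes Z :: "'a \<Rightarrow> 'b::{real_normed_vector,second_countable_topology}"
  assumes P: "prob_space P" and Z: "Z \<in> L2 P norm UNIV" and i: "i \<in> I"
  shows "(\<lambda>\<omega>. Z (\<omega> i)) \<in> L2 (PiM I (\<lambda>_. P)) norm UNIV"
proof (rule L2_I)
  have c: "(\<lambda>\<omega>. \<omega> i) \<in> PiM I (\<lambda>_. P) \<rightarrow>\<^sub>M P" using i by (rule measurable_component_singleton)
  show "(\<lambda>\<omega>. Z (\<omega> i)) \<in> borel_measurable (PiM I (\<lambda>_. P))"
    using c L2_measurable[OF Z] by (rule measurable_compose)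
  have "distr (PiM I (\<lambda>_. P)) P (\<lambda>\<omega>. \<omega> i) = P" using P i by (intro distr_PiM_component) auto
  then show "integrable (PiM I (\<lambda>_. P)) (\<lambda>\<omega>. (norm (Z (\<omega> i)))\<^sup>2)"
    using integrable_distr[OF c, of "\<lambda>x. (norm (Z x))\<^sup>2"] L2_integrable[OF Z] by simp
qed simp

lemma L2_PiM_sum:
  fixes Z :: "'a \<Rightarrow> 'b::{real_normed_vector,second_countable_topology}"
  assumes P: "prob_space P" and Z: "Z \<in> L2 P norm UNIV"
  shows "(\<lambda>\<omega>. c + (\<Sum>i<m. Z (\<omega> i))) \<in> L2 (PiM {..<m::nat} (\<lambda>_. P)) norm UNIV"
proof -
  interpret PP: prob_space "PiM {..<m} (\<lambda>_. P)" by (rule prob_space_PiM) (rule P)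
  show ?thesis
    by (intro L2_add[of _ _ UNIV _ UNIV] L2_const PP.finite_measure_axioms L2_sum L2_PiM_component P Z) auto
qed

text \<open>Integrating out the last coordinate kills the cross term, because \<open>Z\<close> is centred.\<close>
theorem iid_sum_second_moment:
  fixes Z :: "'a \<Rightarrow> 'b::{real_inner,complete_space,second_countable_topology}"
  assumes P: "prob_space P" and Z: "Z \<in> L2 P norm UNIV" and mean: "(\<integral>\<omega>. Z \<omega> \<partial>P) = 0"
  shows "(\<integral>\<omega>. (norm (c + (\<Sum>i<m. Z (\<omega> i))))\<^sup>2 \<partial>PiM {..<m::nat} (\<lambda>_. P))
     = (norm c)\<^sup>2 + real m * (\<integral>\<omega>. (norm (Z \<omega>))\<^sup>2 \<partial>P)"
proof (induction m)
  case 0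
  interpret prob_space "PiM ({} :: nat set) (\<lambda>_. P)" by (rule prob_space_PiM) (rule P)
  show ?case by (simp add: prob_space)
next
  case (Suc m)
  interpret P: prob_space P by (rule P)
  interpret product_sigma_finite "\<lambda>_::nat. P" ..
  interpret PP: prob_space "PiM {..<m} (\<lambda>_. P)" by (rule prob_space_PiM) (rule P)
  \<comment> \<open>\<open>S x\<close> collects \<open>c\<close> and the first \<open>m\<close>
    samples and is frozen while the last sample is integrated. Keeping \<open>c\<close> in the sum
    yields bias and variance in one identity.\<close>
  define S where "S x = c + (\<Sum>i<m. Z (x i))" for x
  let ?\<sigma> = "\<integral>\<omega>. (norm (Z \<omega>))\<^sup>2 \<partial>P"
  have S: "S \<in> L2 (PiM {..<m} (\<lambda>_. P)) norm UNIV" unfolding S_def by (rule L2_PiM_sum[OF P Z])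
  have iZ: "integrable P Z" by (rule L2_prob_integrable[OF P Z])
  have inner: "(\<integral>y. (norm (s + Z y))\<^sup>2 \<partial>P) = (norm s)\<^sup>2 + ?\<sigma>" for s
  proof -
    have "(norm (s + Z y))\<^sup>2 = (norm s)\<^sup>2 + (2 * (s \<bullet> Z y) + (norm (Z y))\<^sup>2)" for y
      by (simp add: power2_norm_eq_inner inner_add_left inner_add_right inner_commute)
    moreover have "integrable P (\<lambda>y. 2 * (s \<bullet> Z y))"
      using integrable_bounded_linear[OF bounded_linear_inner_right iZ] by simp
    moreover have "(\<integral>y. s \<bullet> Z y \<partial>P) = 0"
      using integral_bounded_linear[OF bounded_linear_inner_right iZ, of s] mean by simp
    ultimately show ?thesis using L2_integrable[OF Z] by (simp add: P.prob_space)
  qed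
  have "(\<integral>\<omega>. (norm (c + (\<Sum>i<Suc m. Z (\<omega> i))))\<^sup>2 \<partial>PiM {..<Suc m} (\<lambda>_. P))
      = (\<integral>\<omega>. (norm (c + (\<Sum>i<Suc m. Z (\<omega> i))))\<^sup>2 \<partial>PiM (insert m {..<m}) (\<lambda>_. P))"
    by (simp only: lessThan_Suc)
  also have "\<dots> = (\<integral>x. (\<integral>y. (norm (c + (\<Sum>i<Suc m. Z ((x(m := y)) i))))\<^sup>2 \<partial>P) \<partial>PiM {..<m} (\<lambda>_. P))"
  proof (rule product_integral_insert)
    show "integrable (PiM (insert m {..<m}) (\<lambda>_. P)) (\<lambda>\<omega>. (norm (c + (\<Sum>i<Suc m. Z (\<omega> i))))\<^sup>2)"
      by (subst lessThan_Suc[symmetric]) (rule L2_integrable[OF L2_PiM_sum[OF P Z]])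
  qed auto
  also have "\<dots> = (\<integral>x. (\<integral>y. (norm (S x + Z y))\<^sup>2 \<partial>P) \<partial>PiM {..<m} (\<lambda>_. P))"
    by (simp add: S_def add.assoc)
  also have "\<dots> = (\<integral>x. (norm (S x))\<^sup>2 \<partial>PiM {..<m} (\<lambda>_. P)) + ?\<sigma>"
    unfolding inner using L2_integrable[OF S] by (simp add: PP.prob_space)
  also have "\<dots> = (norm c)\<^sup>2 + real (Suc m) * ?\<sigma>"
    using Suc.IH by (simp add: S_def algebra_simps)
  finally show ?case .
qed

text \<open>Bias-variance decomposition, with \<open>\<mu>\<close> allowed to differ from the mean
  of \<open>Y\<close>. The variance is bounded by the second moment, so a bound on the L2 norm of
  \<open>Y\<close> is enough for the sampling constant; \<open>sqrt (a^2 + b^2) \<le> a + b\<close>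
  separates the two parts.\<close>

theorem Monte_Carlo_error:
  fixes Y :: "'a \<Rightarrow> 'b::{real_inner,complete_space,second_countable_topology}"
  assumes P: "prob_space P" and Y: "Y \<in> L2 P norm UNIV" and m: "m \<ge> 1"
  shows "L2norm (PiM {..<m} (\<lambda>_. P)) norm (\<lambda>\<omega>s. \<mu> - mc_mean m Y \<omega>s)
    \<le> norm (\<mu> - (\<integral>\<omega>. Y \<omega> \<partial>P)) + L2norm P norm Y / sqrt (real m)"
proof -
  interpret P: prob_space P by (rule P)
  define \<nu> where "\<nu> = (\<integral>\<omega>. Y \<omega> \<partial>P)"
  \<comment> \<open>The factor makes \<open>\<mu> - mc_mean m Y\<close> the bias
    \<open>\<mu> - \<nu>\<close> plus the plain sum of the centred \<open>Z\<close>. Its square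
    times the number \<open>m\<close> of summands leaves \<open>1 / m\<close>.\<close>
  define Z where "Z \<omega> = (- 1 / real m) *\<^sub>R (Y \<omega> - \<nu>)" for \<omega>
  have Z: "Z \<in> L2 P norm UNIV" unfolding Z_def
    by (intro L2_scaleR[of _ _ UNIV] L2_diff[OF Y L2_const] P.finite_measure_axioms)
  have iY: "integrable P Y" by (rule L2_prob_integrable[OF P Y])
  have mean: "(\<integral>\<omega>. Z \<omega> \<partial>P) = 0"
    unfolding Z_def using iY integral_scaleR_left[of \<nu> P "\<lambda>_. 1"] by (simp add: P.prob_space \<nu>_def)
  have eq: "\<mu> - mc_mean m Y \<omega>s = (\<mu> - \<nu>) + (\<Sum>i<m. Z (\<omega>s i))" for \<omega>s
  proof -
    have "(\<Sum>i<m. Z (\<omega>s i)) = (- 1 / real m) *\<^sub>R ((\<Sum>i<m. Y (\<omega>s i)) - real m *\<^sub>R \<nu>)"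
      unfolding Z_def scaleR_sum_right[symmetric] by (simp add: sum_subtractf sum_constant_scaleR)
    also have "\<dots> = \<nu> - mc_mean m Y \<omega>s"
      using m unfolding mc_mean_def scaleR_diff_right by simp
    finally show ?thesis by simp
  qed
  have var: "(\<integral>\<omega>. (norm (Y \<omega> - \<nu>))\<^sup>2 \<partial>P) \<le> (L2norm P norm Y)\<^sup>2"
  proof -
    have "(norm (Y \<omega> - \<nu>))\<^sup>2 = (norm (Y \<omega>))\<^sup>2 - 2 * (\<nu> \<bullet> Y \<omega>) + (norm \<nu>)\<^sup>2" for \<omega>
      by (simp add: power2_norm_eq_inner inner_diff_left inner_diff_right inner_commute)
    moreover have "integrable P (\<lambda>y. 2 * (\<nu> \<bullet> Y y))"
      using integrable_bounded_linear[OF bounded_linear_inner_right iY] by simp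
    moreover have "(\<integral>y. \<nu> \<bullet> Y y \<partial>P) = (norm \<nu>)\<^sup>2"
      using integral_bounded_linear[OF bounded_linear_inner_right iY, of \<nu>]
      by (simp add: \<nu>_def power2_norm_eq_inner)
    ultimately show ?thesis using L2_integrable[OF Y] by (simp add: P.prob_space L2norm_power2)
  qed
  have "(\<integral>\<omega>. (norm (Z \<omega>))\<^sup>2 \<partial>P) = (\<integral>\<omega>. (norm (Y \<omega> - \<nu>))\<^sup>2 \<partial>P) / (real m)\<^sup>2"
    by (simp add: Z_def power_divide)
  then have "real m * (\<integral>\<omega>. (norm (Z \<omega>))\<^sup>2 \<partial>P) = (\<integral>\<omega>. (norm (Y \<omega> - \<nu>))\<^sup>2 \<partial>P) / real m"
    using m by (simp add: power2_eq_square)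
  also have "\<dots> \<le> (L2norm P norm Y)\<^sup>2 / real m" by (intro divide_right_mono var) simp
  also have "\<dots> = (L2norm P norm Y / sqrt (real m))\<^sup>2" by (simp add: power_divide)
  finally have "L2norm (PiM {..<m} (\<lambda>_. P)) norm (\<lambda>\<omega>s. \<mu> - mc_mean m Y \<omega>s)
      \<le> sqrt ((norm (\<mu> - \<nu>))\<^sup>2 + (L2norm P norm Y / sqrt (real m))\<^sup>2)"
    unfolding L2norm_def[of "PiM _ _"] eq iid_sum_second_moment[OF P Z mean]
    by (intro real_sqrt_le_mono) simp
  also have "\<dots> \<le> norm (\<mu> - \<nu>) + L2norm P norm Y / sqrt (real m)"
    by (intro sqrt_sum_squares_le_sum) (simp_all add: L2norm_nonneg)
  finally show ?thesis by (simp add: \<nu>_def)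
qed

section \<open>Discretisation error\<close>

lemma linear_on_subset: "linear_on T f \<Longrightarrow> S \<subseteq> T \<Longrightarrow> linear_on S f"
  unfolding linear_on_def by blast

lemma linear_on_sum:
  assumes f: "linear_on S f" and S: "subspace S" and I: "finite I" "\<And>i. i \<in> I \<Longrightarrow> b i \<in> S"
  shows "f (\<Sum>i\<in>I. c i *\<^sub>R b i) = (\<Sum>i\<in>I. c i *\<^sub>R f (b i))"
  using I
proof (induction I rule: finite_induct)
  case empty
  show ?case using linear_on_0[OF f subspace_0[OF S]] by simp
next
  case (insert i I)
  have "(\<Sum>i\<in>I. c i *\<^sub>R b i) \<in> S" "c i *\<^sub>R b i \<in> S"
    using insert by (auto intro!: subspace_sum[OF S] subspace_scale[OF S])
  then show ?case using insert f by (simp add: linear_on_def)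
qed

text \<open>Exhibits the lifted discrete space as a finite span in \<open>'v\<close>, so that the
  projection and measurability results apply to it.\<close>

lemma linear_on_span_image:
  assumes f: "linear_on (span B) f" and B: "finite B"
  shows "f ` span B = span (f ` B)"
proof
  show "f ` span B \<subseteq> span (f ` B)"
  proof
    fix y assume "y \<in> f ` span B"
    then obtain c where "y = f (\<Sum>b\<in>B. c b *\<^sub>R b)" using span_finite[OF B] by auto
    then have "y = (\<Sum>b\<in>B. c b *\<^sub>R f b)"
      using linear_on_sum[OF f subspace_span B, of "\<lambda>b. b" c] by (simp add: span_base)
    then show "y \<in> span (f ` B)" by (simp add: span_sum span_mul span_base)
  qed
  show "span (f ` B) \<subseteq> f ` span B"
  proof (rule span_minimal)
    show "f ` B \<subseteq> f ` span B" by (intro image_mono span_superset)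
    show "subspace (f ` span B)"
    proof (rule subspaceI)
      show "0 \<in> f ` span B" using linear_on_0[OF f span_zero] span_zero[of B] by (metis image_eqI)
      show "x + y \<in> f ` span B" if "x \<in> f ` span B" "y \<in> f ` span B" for x y
        using that f span_add[of _ B] unfolding linear_on_def by (smt (verit) image_iff)
      show "c *\<^sub>R x \<in> f ` span B" if "x \<in> f ` span B" for c x
        using that f span_mul[of _ B] unfolding linear_on_def by (smt (verit) image_iff)
    qed
  qed
qed

text \<open>Coordinates of the first argument in a basis are linear, hence measurable, so the form
  becomes a finite sum of products of measurable functions. It serves the discrete inner product,
  whose relation to the norm of \<open>'d\<close> is unspecified.\<close>

lemma bilinear_on_finite_span_measurable:
  fixes \<beta> :: "'d::real_normed_vector \<Rightarrow> 'd \<Rightarrow> real"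
  assumes B: "finite B"
    and left: "\<And>y. y \<in> span B \<Longrightarrow> linear_on (span B) (\<lambda>x. \<beta> x y)"
    and right: "\<And>x. x \<in> span B \<Longrightarrow> linear_on (span B) (\<beta> x)"
    and X: "X \<in> borel_measurable P" "\<And>\<omega>. \<omega> \<in> space P \<Longrightarrow> X \<omega> \<in> span B"
    and Y: "Y \<in> borel_measurable P" "\<And>\<omega>. \<omega> \<in> space P \<Longrightarrow> Y \<omega> \<in> span B"
  shows "(\<lambda>\<omega>. \<beta> (X \<omega>) (Y \<omega>)) \<in> borel_measurable P"
proof -
  obtain E where E: "E \<subseteq> B" "independent E" "span B \<subseteq> span E"
    using maximal_independent_subset[of B] span_minimal[OF _ subspace_span, of B]
    by (metis subset_trans)
  have fin: "finite E" and sp: "span E = span B"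
    using E B finite_subset span_mono[OF E(1)] by auto
  have rep: "linear_on (span B) (\<lambda>x. representation E x b)" for b
    unfolding linear_on_def sp[symmetric] using E(2) by (simp add: representation_add representation_scale)
  have m: "(\<lambda>\<omega>. representation E (X \<omega>) b * \<beta> b (Y \<omega>)) \<in> borel_measurable P" if "b \<in> E" for b
    using linear_on_finite_span_measurable[OF B rep X, of b]
      linear_on_finite_span_measurable[OF B right Y, of b] that span_base[OF that] sp by simp
  have eq: "\<beta> (X \<omega>) (Y \<omega>) = (\<Sum>b\<in>E. representation E (X \<omega>) b * \<beta> b (Y \<omega>))" if "\<omega> \<in> space P" for \<omega>
    using linear_on_sum[OF left[OF Y(2)[OF that]] subspace_span fin, of "\<lambda>b. b" "representation E (X \<omega>)"]
      sum_representation_eq[OF E(2) _ fin subset_refl, of "X \<omega>"] X(2)[OF that]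
    by (simp add: sp[symmetric] span_base)
  show ?thesis by (subst measurable_cong[OF eq]) (auto intro!: borel_measurable_sum m)
qed

lemma fun_bilinear_on_diff:
  fixes B :: "('a \<Rightarrow> 'v::{real_normed_vector,second_countable_topology}) \<Rightarrow> ('a \<Rightarrow> 'v) \<Rightarrow> real"
  assumes B: "fun_bilinear_on (L2 P norm UNIV) B"
    and xyz: "x \<in> L2 P norm UNIV" "y \<in> L2 P norm UNIV" "z \<in> L2 P norm UNIV"
  shows "B (\<lambda>\<omega>. x \<omega> - y \<omega>) z = B x z - B y z" and "B z (\<lambda>\<omega>. x \<omega> - y \<omega>) = B z x - B z y"
proof -
  let ?y = "\<lambda>\<omega>. (-1) *\<^sub>R y \<omega>"
  have y: "?y \<in> L2 P norm UNIV" by (rule L2_scaleR[OF xyz(2)])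
  have add: "B (\<lambda>\<omega>. f \<omega> + g \<omega>) h = B f h + B g h \<and> B h (\<lambda>\<omega>. f \<omega> + g \<omega>) = B h f + B h g"
    if "f \<in> L2 P norm UNIV" "g \<in> L2 P norm UNIV" "h \<in> L2 P norm UNIV" for f g h
    using B[unfolded fun_bilinear_on_def] that by blast
  have scale: "B (\<lambda>\<omega>. r *\<^sub>R f \<omega>) g = r * B f g \<and> B f (\<lambda>\<omega>. r *\<^sub>R g \<omega>) = r * B f g"
    if "f \<in> L2 P norm UNIV" "g \<in> L2 P norm UNIV" for f g r
    using B[unfolded fun_bilinear_on_def] that by blast
  note add[OF xyz(1) y xyz(3)] scale[OF xyz(2,3), of "-1"] scale[OF xyz(3,2), of "-1"]
  then show "B (\<lambda>\<omega>. x \<omega> - y \<omega>) z = B x z - B y z" "B z (\<lambda>\<omega>. x \<omega> - y \<omega>) = B z x - B z y"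
    by simp_all
qed

text \<open>\<open>d\<close> is kept separate from \<open>x\<close> and \<open>y\<close> because it
  will be the inverse lift of a difference, while \<open>x\<close> and \<open>y\<close> are the
  inverse lifts of its two terms.\<close>

lemma bform_diff_left:
  assumes "integrable P (\<lambda>\<omega>. B \<omega> (x \<omega>) (z \<omega>))" "integrable P (\<lambda>\<omega>. B \<omega> (y \<omega>) (z \<omega>))"
    and "\<And>\<omega>. \<omega> \<in> space P \<Longrightarrow> B \<omega> (d \<omega>) (z \<omega>) = B \<omega> (x \<omega>) (z \<omega>) - B \<omega> (y \<omega>) (z \<omega>)"
  shows "bform P B d z = bform P B x z - bform P B y z"
proof -
  have "bform P B d z = (\<integral>\<omega>. B \<omega> (x \<omega>) (z \<omega>) - B \<omega> (y \<omega>) (z \<omega>) \<partial>P)"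
    unfolding bform_def using assms(3) by (rule Bochner_Integration.integral_cong[OF refl])
  then show ?thesis using assms(1,2) by (simp add: bform_def)
qed

lemma bform_diff_right:
  assumes "integrable P (\<lambda>\<omega>. B \<omega> (z \<omega>) (x \<omega>))" "integrable P (\<lambda>\<omega>. B \<omega> (z \<omega>) (y \<omega>))"
    and "\<And>\<omega>. \<omega> \<in> space P \<Longrightarrow> B \<omega> (z \<omega>) (d \<omega>) = B \<omega> (z \<omega>) (x \<omega>) - B \<omega> (z \<omega>) (y \<omega>)"
  shows "bform P B z d = bform P B z x - bform P B z y"
proof -
  have "bform P B z d = (\<integral>\<omega>. B \<omega> (z \<omega>) (x \<omega>) - B \<omega> (z \<omega>) (y \<omega>) \<partial>P)"
    unfolding bform_def using assms(3) by (rule Bochner_Integration.integral_cong[OF refl])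
  then show ?thesis using assms(1,2) by (simp add: bform_def)
qed

text \<open>Used to replace \<open>u\<close> and the dual solution by representatives with values in
  the image of Z_0 at every sample.\<close>

lemma bform_cong_AE:
  assumes "integrable P (\<lambda>\<omega>. B \<omega> (x \<omega>) (y \<omega>))" "integrable P (\<lambda>\<omega>. B \<omega> (x' \<omega>) (y' \<omega>))"
    and "AE \<omega> in P. x \<omega> = x' \<omega>" "AE \<omega> in P. y \<omega> = y' \<omega>"
  shows "bform P B x y = bform P B x' y'"
  unfolding bform_def
  using assms by (intro integral_cong_AE) (auto elim: eventually_elim2)

lemma bilinear_on_diff:
  assumes "bilinear_on S B" "subspace S" "x \<in> S" "y \<in> S" "z \<in> S"
  shows "B (x - y) z = B x z - B y z" "B z (x - y) = B z x - B z y"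
proof -
  have y: "(-1) *\<^sub>R y \<in> S" using assms by (intro subspace_scale)
  have "B (x + (-1) *\<^sub>R y) z = B x z + B ((-1) *\<^sub>R y) z" "B ((-1) *\<^sub>R y) z = (-1) * B y z"
    "B z (x + (-1) *\<^sub>R y) = B z x + B z ((-1) *\<^sub>R y)" "B z ((-1) *\<^sub>R y) = (-1) * B z y"
    using assms y unfolding bilinear_on_def by blast+
  then show "B (x - y) z = B x z - B y z" "B z (x - y) = B z x - B z y" by simp_all
qed

lemma inner_product_on_linear:
  assumes ip: "inner_product_on S ip" and T: "subspace T" "T \<subseteq> S" and y: "y \<in> T"
  shows "linear_on T (\<lambda>x. ip x y)" "linear_on T (ip y)"
proof -
  have inS: "x \<in> S" if "x \<in> T" for x using that T(2) by (rule subsetD[rotated])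
  note ip' = ip[unfolded inner_product_on_def]
  note sym' = conjunct1[OF ip'] and add' = conjunct1[OF conjunct2[OF ip']]
    and scale' = conjunct1[OF conjunct2[OF conjunct2[OF ip']]]
  have sym: "ip y x = ip x y" if "x \<in> T" for x
    using sym' inS[OF y] inS[OF that] by blast
  note add = add'[rule_format, OF inS inS inS[OF y]] and scale = scale'[rule_format, OF inS inS[OF y]]
  show "linear_on T (\<lambda>x. ip x y)" unfolding linear_on_def by (simp add: add scale)
  show "linear_on T (ip y)" unfolding linear_on_def
    by (simp add: sym add scale subspace_add[OF T(1)] subspace_scale[OF T(1)])
qed

lemma subspace_lift_plus_Z:
  assumes S: "subspace (f ` S)" and g: "linear g"
  shows "subspace (lift_plus_Z f S g)"
proof -
  have "lift_plus_Z f S g = {x + y | x y. x \<in> f ` S \<and> y \<in> range g}"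
    unfolding lift_plus_Z_def by blast
  then show ?thesis using subspace_sums[OF S linear_subspace_image[OF g subspace_UNIV]] by simp
qed

text \<open>(R1) is a regularity statement about a dual solution that is already given, so existence
  has to be supplied. The right-hand side is bounded by Cauchy-Schwarz and continuity of
  \<open>emb\<close>.\<close>

lemma dual_solution_exists:
  fixes emb :: "'v::{real_inner,complete_space,second_countable_topology} \<Rightarrow> 'h::{real_inner,second_countable_topology}"
  assumes P: "prob_space P" and emb: "bounded_linear emb"
    and bil: "fun_bilinear_on (L2 P norm UNIV) B"
    and bdd: "\<And>x y. x \<in> L2 P norm UNIV \<Longrightarrow> y \<in> L2 P norm UNIV
        \<Longrightarrow> \<bar>B x y\<bar> \<le> C * L2norm P norm x * L2norm P norm y"
    and c: "c > 0" and coer: "\<And>x. x \<in> L2 P norm UNIV \<Longrightarrow> c * (L2norm P norm x)\<^sup>2 \<le> B x x"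
    and g: "g \<in> L2 P norm UNIV"
  shows "\<exists>w\<in>L2 P norm UNIV. \<forall>\<phi>\<in>L2 P norm UNIV. B \<phi> w = (\<integral>\<omega>. g \<omega> \<bullet> emb (\<phi> \<omega>) \<partial>P)"
proof -
  obtain k where k: "0 \<le> k" "\<And>x. norm (emb x) \<le> k * norm x"
    using bounded_linear.nonneg_bounded[OF emb] by (auto simp: mult.commute)
  have emb_L2: "(\<lambda>\<omega>. emb (x \<omega>)) \<in> L2 P norm UNIV" if "x \<in> L2 P norm UNIV" for x
    by (rule L2_bounded_linear[OF emb that])
  show ?thesis
  proof (rule Lax_Milgram_L2[OF P bil bdd c coer, where K="L2norm P norm g * k"])
    show "fun_linear_on (L2 P norm UNIV) (\<lambda>\<phi>. \<integral>\<omega>. g \<omega> \<bullet> emb (\<phi> \<omega>) \<partial>P)"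
      unfolding fun_linear_on_def
      by (simp add: linear_add[OF bounded_linear.linear[OF emb]] linear_scale[OF bounded_linear.linear[OF emb]]
          inner_add_right Bochner_Integration.integral_add L2_inner_integrable[OF g emb_L2])
    show "\<bar>\<integral>\<omega>. g \<omega> \<bullet> emb (x \<omega>) \<partial>P\<bar> \<le> L2norm P norm g * k * L2norm P norm x"
      if x: "x \<in> L2 P norm UNIV" for x
    proof -
      have "\<bar>\<integral>\<omega>. g \<omega> \<bullet> emb (x \<omega>) \<partial>P\<bar> \<le> L2norm P norm g * L2norm P norm (\<lambda>\<omega>. emb (x \<omega>))"
        using semi_inner_space.Cauchy_Schwarz_ip[OF semi_inner_space_L2 g emb_L2[OF x]]
        by (simp add: L2norm_def dot_square_norm)
      also have "\<dots> \<le> L2norm P norm g * (k * L2norm P norm x)"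
        by (intro mult_left_mono L2_dominated_norm[OF L2_measurable[OF emb_L2[OF x]] _ x k(1)] k L2norm_nonneg) auto
      finally show ?thesis by (simp add: ac_simps)
    qed
  qed
qed

theorem mainTheorem11:
  fixes P :: "'a measure"
    and emb :: "'v::{real_inner,complete_space,second_countable_topology} \<Rightarrow> 'h::{real_inner,complete_space,second_countable_topology}"
    and embZ :: "'z::{real_inner,complete_space,second_countable_topology} \<Rightarrow> 'v"
    and acont :: "'a \<Rightarrow> 'v \<Rightarrow> 'v \<Rightarrow> real"
    and lcont :: "'a \<Rightarrow> 'h \<Rightarrow> real"
    and u :: "'a \<Rightarrow> 'v"
    and h0 :: real
    and Vsp Vh Hh :: "real \<Rightarrow> 'd::real_normed_vector set"
    and ipV ipH :: "real \<Rightarrow> 'd \<Rightarrow> 'd \<Rightarrow> real"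
    and aht :: "real \<Rightarrow> 'a \<Rightarrow> 'd \<Rightarrow> 'd \<Rightarrow> real"
    and lht :: "real \<Rightarrow> 'a \<Rightarrow> 'd \<Rightarrow> real"
    and U :: "real \<Rightarrow> 'a \<Rightarrow> 'd"
    and lift :: "real \<Rightarrow> 'd \<Rightarrow> 'v"
    and Ih :: "real \<Rightarrow> 'z \<Rightarrow> 'v"
    and invl :: "real \<Rightarrow> 'v \<Rightarrow> 'd"
    and ca Ca Cl cHV c1 c2 c3 cL1 cL2 cI cP1 cP2 cP3 cR :: real
  assumes prob: "prob_space P" and compl: "complete_measure P" and sep: "separable_measure P"
    (* V \<hookrightarrow> H densely and continuously *)
    and emb_lin: "bounded_linear emb" and emb_inj: "inj emb" and emb_dense: "closure (range emb) = UNIV"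
    (* the continuous problem *)
    and a_def: "\<forall>x\<in>L2 P norm UNIV. \<forall>y\<in>L2 P norm UNIV. integrable P (\<lambda>\<omega>. acont \<omega> (x \<omega>) (y \<omega>))"
    and a_bil: "fun_bilinear_on (L2 P norm UNIV) (bform P acont)"
    and a_bdd: "\<forall>x\<in>L2 P norm UNIV. \<forall>y\<in>L2 P norm UNIV.
                  \<bar>bform P acont x y\<bar> \<le> Ca * L2norm P norm x * L2norm P norm y"
    and ca_pos: "ca > 0"
    and a_coer: "\<forall>x\<in>L2 P norm UNIV. bform P acont x x \<ge> ca * (L2norm P norm x)\<^sup>2"
    and l_def: "\<forall>x\<in>L2 P norm (UNIV::'h set). integrable P (\<lambda>\<omega>. lcont \<omega> (x \<omega>))"
    and l_lin: "fun_linear_on (L2 P norm UNIV) (lform P lcont)"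
    and l_bdd: "\<forall>x\<in>L2 P norm UNIV. \<bar>lform P lcont x\<bar> \<le> Cl * L2norm P norm x"
    and u_L2: "u \<in> L2 P norm UNIV"
    and u_sol: "\<forall>\<phi>\<in>L2 P norm UNIV. bform P acont u \<phi> = lform P lcont (\<lambda>\<omega>. emb (\<phi> \<omega>))"
    and u_Z: "\<exists>uz\<in>L2 P norm (UNIV::'z set). AE \<omega> in P. u \<omega> = embZ (uz \<omega>)"
    (* Z_0 \<hookrightarrow> V *)
    and embZ_lin: "bounded_linear embZ" and embZ_inj: "inj embZ"
    and h0_pos: "h0 > 0"
    (* the discrete spaces *)
    and Vh_hilb: "\<forall>h\<in>{0<..<h0}. hilbert_on (Vh h) (ipV h)"
    and Hh_hilb: "\<forall>h\<in>{0<..<h0}. hilbert_on (Hh h) (ipH h)"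
    and Vh_Hh: "\<forall>h\<in>{0<..<h0}. Vh h \<subseteq> Hh h \<and>
                  (\<exists>c. \<forall>x\<in>Vh h. ip_norm (ipH h) x \<le> c * ip_norm (ipV h) x)"
    and Vsp_sub: "\<forall>h\<in>{0<..<h0}. subspace (Vsp h) \<and> Vsp h \<subseteq> Vh h \<and> (\<exists>B. finite B \<and> span B = Vsp h)"
    and HV_unif: "\<forall>h\<in>{0<..<h0}. \<forall>\<xi>\<in>Vsp h. ip_norm (ipH h) \<xi> \<le> cHV * ip_norm (ipV h) \<xi>"
    (* the discrete forms *)
    and ah_bil: "\<forall>h\<in>{0<..<h0}. \<forall>\<omega>\<in>space P. bilinear_on (Vh h) (aht h \<omega>)"
    and lh_lin: "\<forall>h\<in>{0<..<h0}. \<forall>\<omega>\<in>space P. linear_on (Vh h) (lht h \<omega>)"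
    and c1_pos: "c1 > 0"
    and ah_coer: "\<forall>h\<in>{0<..<h0}. \<forall>\<omega>\<in>space P. \<forall>\<xi>\<in>Vsp h. aht h \<omega> \<xi> \<xi> \<ge> c1 * (ip_norm (ipV h) \<xi>)\<^sup>2"
    and ah_bdd: "\<forall>h\<in>{0<..<h0}. \<forall>\<omega>\<in>space P. \<forall>\<xi>\<in>Vsp h. \<forall>W\<in>Vsp h.
                   \<bar>aht h \<omega> \<xi> W\<bar> \<le> c2 * ip_norm (ipV h) \<xi> * ip_norm (ipV h) W"
    and lh_bdd: "\<forall>h\<in>{0<..<h0}. \<forall>\<omega>\<in>space P. \<forall>\<xi>\<in>Vsp h. \<bar>lht h \<omega> \<xi>\<bar> \<le> c3 * ip_norm (ipH h) \<xi>"
    and ah_def: "\<forall>h\<in>{0<..<h0}. \<forall>X\<in>L2 P (ip_norm (ipV h)) (Vsp h). \<forall>Y\<in>L2 P (ip_norm (ipV h)) (Vsp h).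
                   integrable P (\<lambda>\<omega>. aht h \<omega> (X \<omega>) (Y \<omega>)) \<and> integrable P (\<lambda>\<omega>. lht h \<omega> (X \<omega>))"
    and U_L2: "\<forall>h\<in>{0<..<h0}. U h \<in> L2 P (ip_norm (ipV h)) (Vsp h)"
    and U_sol: "\<forall>h\<in>{0<..<h0}. \<forall>\<phi>\<in>L2 P (ip_norm (ipV h)) (Vsp h). bform P (aht h) (U h) \<phi> = lform P (lht h) \<phi>"
    (* (L1), (L2): the lift *)
    and lift_lin: "\<forall>h\<in>{0<..<h0}. linear_on (Vsp h) (lift h)"
    and cL1_pos: "cL1 > 0"
    and lift_H: "\<forall>h\<in>{0<..<h0}. \<forall>\<xi>\<in>Vsp h. cL1 * ip_norm (ipH h) \<xi> \<le> norm (emb (lift h \<xi>))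
                   \<and> norm (emb (lift h \<xi>)) \<le> cL2 * ip_norm (ipH h) \<xi>"
    and lift_V: "\<forall>h\<in>{0<..<h0}. \<forall>\<xi>\<in>Vsp h. cL1 * ip_norm (ipV h) \<xi> \<le> norm (lift h \<xi>)
                   \<and> norm (lift h \<xi>) \<le> cL2 * ip_norm (ipV h) \<xi>"
    (* (I1) *)
    and Ih_prop: "\<forall>h\<in>{0<..<h0}. \<forall>\<eta>. Ih h \<eta> \<in> lift h ` Vsp h
                   \<and> norm (emb (embZ \<eta> - Ih h \<eta>)) + h * norm (embZ \<eta> - Ih h \<eta>) \<le> cI * h\<^sup>2 * norm \<eta>"
    (* inverse lift *)
    and invl_lin: "\<forall>h\<in>{0<..<h0}. linear_on (lift_plus_Z (lift h) (Vsp h) embZ) (invl h)"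
    and invl_into: "\<forall>h\<in>{0<..<h0}. \<forall>x\<in>lift_plus_Z (lift h) (Vsp h) embZ. invl h x \<in> Vh h"
    and invl_ext: "\<forall>h\<in>{0<..<h0}. \<forall>\<xi>\<in>Vsp h. invl h (lift h \<xi>) = \<xi>"
    and ahl_def: "\<forall>h\<in>{0<..<h0}. \<forall>w\<in>L2 P norm (lift_plus_Z (lift h) (Vsp h) embZ).
                   \<forall>\<phi>\<in>L2 P norm (lift_plus_Z (lift h) (Vsp h) embZ).
                   integrable P (\<lambda>\<omega>. aht h \<omega> (invl h (w \<omega>)) (invl h (\<phi> \<omega>)))"
    and lhl_def: "\<forall>h\<in>{0<..<h0}. \<forall>\<phi>\<in>L2 P norm (lift h ` Vsp h).
                   integrable P (\<lambda>\<omega>. lht h \<omega> (invl h (\<phi> \<omega>)))"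
    (* consistency (P1)-(P3) *)
    and P1: "\<forall>h\<in>{0<..<h0}. \<forall>\<phi>\<in>L2 P norm (lift h ` Vsp h).
               \<bar>lform P lcont (\<lambda>\<omega>. emb (\<phi> \<omega>)) - lform P (lht h) (\<lambda>\<omega>. invl h (\<phi> \<omega>))\<bar>
                 \<le> cP1 * h\<^sup>2 * L2norm P norm (\<lambda>\<omega>. emb (\<phi> \<omega>))"
    and P2: "\<forall>h\<in>{0<..<h0}. \<forall>w\<in>L2 P norm (lift_plus_Z (lift h) (Vsp h) embZ).
               \<forall>\<phi>\<in>L2 P norm (lift_plus_Z (lift h) (Vsp h) embZ).
               \<bar>bform P acont w \<phi> - bform P (aht h) (\<lambda>\<omega>. invl h (w \<omega>)) (\<lambda>\<omega>. invl h (\<phi> \<omega>))\<bar>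
                 \<le> cP2 * h * L2norm P norm w * L2norm P norm \<phi>"
    and P3: "\<forall>h\<in>{0<..<h0}. \<forall>w\<in>L2 P norm (UNIV::'z set). \<forall>\<phi>\<in>L2 P norm (UNIV::'z set).
               \<bar>bform P acont (\<lambda>\<omega>. embZ (w \<omega>)) (\<lambda>\<omega>. embZ (\<phi> \<omega>))
                 - bform P (aht h) (\<lambda>\<omega>. invl h (embZ (w \<omega>))) (\<lambda>\<omega>. invl h (embZ (\<phi> \<omega>)))\<bar>
                 \<le> cP3 * h\<^sup>2 * L2norm P norm w * L2norm P norm \<phi>"
    (* (R1) *)
    and R1: "\<forall>g\<in>L2 P norm (UNIV::'h set). \<forall>w\<in>L2 P norm UNIV.
               (\<forall>\<phi>\<in>L2 P norm UNIV. bform P acont \<phi> w = (\<integral>\<omega>. inner (g \<omega>) (emb (\<phi> \<omega>)) \<partial>P))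
               \<longrightarrow> (\<exists>wz\<in>L2 P norm (UNIV::'z set). (AE \<omega> in P. w \<omega> = embZ (wz \<omega>))
                      \<and> L2norm P norm wz \<le> cR * L2norm P norm g)"
  shows "\<exists>C. \<forall>h\<in>{0<..<h0}. \<forall>m::nat. m \<ge> 1 \<longrightarrow>
           L2norm (PiM {..<m} (\<lambda>_. P)) norm
             (\<lambda>\<omega>s. emb ((\<integral>\<omega>. u \<omega> \<partial>P) - mc_mean m (\<lambda>\<omega>. lift h (U h \<omega>)) \<omega>s))
             \<le> C * (h\<^sup>2 + 1 / sqrt (real m))
         \<and> L2norm (PiM {..<m} (\<lambda>_. P)) norm
             (\<lambda>\<omega>s. (\<integral>\<omega>. u \<omega> \<partial>P) - mc_mean m (\<lambda>\<omega>. lift h (U h \<omega>)) \<omega>s)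
             \<le> C * (h + 1 / sqrt (real m))"
proof -

  \<comment> \<open>Constants, representatives in Z_0 and the dual problem\<close>
  interpret prob_space P by (rule prob)
  obtain uz where uz: "uz \<in> L2 P norm UNIV" and u_uz: "AE \<omega> in P. u \<omega> = embZ (uz \<omega>)"
    using u_Z by blast
  obtain kE where kE: "0 \<le> kE" "\<And>x. norm (emb x) \<le> kE * norm x"
    using bounded_linear.nonneg_bounded[OF emb_lin] by (auto simp: mult.commute)
  obtain kZ where kZ: "0 \<le> kZ" "\<And>x. norm (embZ x) \<le> kZ * norm x"
    using bounded_linear.nonneg_bounded[OF embZ_lin] by (auto simp: mult.commute)
  let ?V = "L2 P norm (UNIV :: 'v set)"
  let ?n = "L2norm P norm"
  define ub where "ub \<omega> = embZ (uz \<omega>)" for \<omega>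
  define R where "R = L2norm P norm uz"
  \<comment> \<open>The upper bounds \<open>cL2\<close>, \<open>Ca\<close>, \<open>cI\<close>,
    \<open>cP1\<close>, \<open>cP2\<close>, \<open>cP3\<close> and \<open>cR\<close> carry no sign,
    so their absolute values enter all constants.\<close>
  define cL where "cL = \<bar>cL2\<bar> + 1"
  \<comment> \<open>The three summands bound the consistency error of the functional, that of the
    form, and the projection error. The factor \<open>cL^2 / c1\<close> is the price of coercivity
    after lifting; \<open>h0\<close> absorbs surplus powers of \<open>h\<close>.\<close>
  define C1 where "C1 = cL\<^sup>2 / c1 * (\<bar>cP1\<bar> * h0 * kE + \<bar>cP2\<bar> * kZ * R + (\<bar>Ca\<bar> + \<bar>cP2\<bar> * h0) * \<bar>cI\<bar> * R)"
  define C2 where "C2 = \<bar>cI\<bar> * R + C1"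
  \<comment> \<open>One summand for each of the five terms into which the duality argument splits
    \<open>(?n g)^2\<close>, with \<open>h^2\<close> and the Z_0-norm of the dual solution factored
    out.\<close>
  define D where "D = \<bar>Ca\<bar> * C2 * \<bar>cI\<bar> + \<bar>cP1\<bar> * kE * kZ + \<bar>cP2\<bar> * C2 * kZ + \<bar>cP2\<bar> * kZ * R * \<bar>cI\<bar> + \<bar>cP3\<bar> * R"
  define C3 where "C3 = D * \<bar>cR\<bar>"
  \<comment> \<open>Bounds the discrete solution in \<open>V\<close> uniformly in \<open>h\<close>,
    and with it the second moment of a sample.\<close>
  define C4 where "C4 = kZ * R + C2 * h0"
  have R0: "0 \<le> R" by (simp add: R_def L2norm_nonneg)
  have C1: "0 \<le> C1" unfolding C1_def using c1_pos h0_pos kE kZ R0 by (intro mult_nonneg_nonneg add_nonneg_nonneg) auto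
  have C2: "0 \<le> C2" unfolding C2_def using C1 R0 by simp
  have D: "0 \<le> D" unfolding D_def using C2 kE kZ R0 by (intro mult_nonneg_nonneg add_nonneg_nonneg) auto
  have C3: "0 \<le> C3" unfolding C3_def using D by simp
  have C4: "0 \<le> C4" unfolding C4_def using C2 kZ R0 h0_pos by simp
  have embZ_L2: "(\<lambda>\<omega>. embZ (z \<omega>)) \<in> ?V" if "z \<in> L2 P norm UNIV" for z
    by (rule L2_bounded_linear[OF embZ_lin that])
  have emb_L2: "(\<lambda>\<omega>. emb (x \<omega>)) \<in> L2 P norm UNIV" if "x \<in> L2 P norm S" for x S
    by (rule L2_bounded_linear[OF emb_lin that])
  have emb_norm: "?n (\<lambda>\<omega>. emb (x \<omega>)) \<le> kE * ?n x" if "x \<in> L2 P norm S" for x S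
    by (rule L2_dominated_norm[OF L2_measurable[OF emb_L2[OF that]] _ that kE(1)]) (auto simp: kE)
  have embZ_norm: "?n (\<lambda>\<omega>. embZ (z \<omega>)) \<le> kZ * L2norm P norm z" if "z \<in> L2 P norm UNIV" for z
    by (rule L2_dominated_norm[OF L2_measurable[OF embZ_L2[OF that]] _ that kZ(1)]) (auto simp: kZ)
  have ub: "ub \<in> ?V" unfolding ub_def by (rule embZ_L2[OF uz])
  have ub_norm: "?n ub \<le> kZ * R" unfolding ub_def R_def by (rule embZ_norm[OF uz])
  have u_ub: "AE \<omega> in P. u \<omega> = ub \<omega>" using u_uz by (simp add: ub_def)
  have ub_sol: "bform P acont ub \<phi> = lform P lcont (\<lambda>\<omega>. emb (\<phi> \<omega>))" if "\<phi> \<in> ?V" for \<phi>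
    using bform_cong_AE[of P acont u \<phi> ub \<phi>] a_def u_L2 ub u_ub u_sol that by simp
  have a_bdd': "\<bar>bform P acont x y\<bar> \<le> \<bar>Ca\<bar> * ?n x * ?n y" if "x \<in> ?V" "y \<in> ?V" for x y
  proof -
    have "\<bar>bform P acont x y\<bar> \<le> Ca * ?n x * ?n y" using a_bdd that by blast
    also have "\<dots> \<le> \<bar>Ca\<bar> * ?n x * ?n y" by (intro mult_right_mono L2norm_nonneg) simp
    finally show ?thesis .
  qed
  have dual: "\<exists>wz\<in>L2 P norm UNIV. L2norm P norm wz \<le> \<bar>cR\<bar> * L2norm P norm g \<and>
      (\<forall>\<phi>\<in>?V. bform P acont \<phi> (\<lambda>\<omega>. embZ (wz \<omega>)) = (\<integral>\<omega>. g \<omega> \<bullet> emb (\<phi> \<omega>) \<partial>P))"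
    if g: "g \<in> L2 P norm UNIV" for g
  proof -
    obtain w where w: "w \<in> ?V" "\<forall>\<phi>\<in>?V. bform P acont \<phi> w = (\<integral>\<omega>. g \<omega> \<bullet> emb (\<phi> \<omega>) \<partial>P)"
      using dual_solution_exists[OF prob emb_lin a_bil a_bdd' ca_pos _ g] a_coer by blast
    then obtain wz where wz: "wz \<in> L2 P norm UNIV" "AE \<omega> in P. w \<omega> = embZ (wz \<omega>)"
      "L2norm P norm wz \<le> cR * L2norm P norm g"
      using R1 g by blast
    have "bform P acont \<phi> (\<lambda>\<omega>. embZ (wz \<omega>)) = bform P acont \<phi> w" if "\<phi> \<in> ?V" for \<phi>
      using bform_cong_AE[of P acont \<phi> w \<phi> "\<lambda>\<omega>. embZ (wz \<omega>)"] a_def w(1) embZ_L2[OF wz(1)] wz(2) that by simp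
    moreover have "cR * L2norm P norm g \<le> \<bar>cR\<bar> * L2norm P norm g"
      by (intro mult_right_mono L2norm_nonneg) simp
    ultimately show ?thesis using w(2) wz by (intro bexI[of _ wz]) auto
  qed

  \<comment> \<open>The lifted discrete problem for a fixed \<open>h\<close>\<close>
  have discr: "(\<lambda>\<omega>. lift h (U h \<omega>)) \<in> ?V
      \<and> ?n (\<lambda>\<omega>. ub \<omega> - lift h (U h \<omega>)) \<le> C2 * h
      \<and> ?n (\<lambda>\<omega>. emb (ub \<omega> - lift h (U h \<omega>))) \<le> C3 * h\<^sup>2" if h: "h \<in> {0<..<h0}" for h
  proof -
    have h_pos: "0 < h" and h_le: "h \<le> h0" using h by auto
    define N where "N = ip_norm (ipV h)"
    define S where "S = lift h ` Vsp h"
    define T where "T = lift_plus_Z (lift h) (Vsp h) embZ"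
    define il where "il = invl h"
    define A where "A w \<phi> = bform P (aht h) (\<lambda>\<omega>. il (w \<omega>)) (\<lambda>\<omega>. il (\<phi> \<omega>))" for w \<phi>
    have Vh: "subspace (Vh h)" and ip: "inner_product_on (Vh h) (ipV h)"
      using Vh_hilb h by (auto simp: hilbert_on_def)
    obtain B where B: "finite B" "span B = Vsp h" using Vsp_sub h by blast
    have Vsp_Vh: "Vsp h \<subseteq> Vh h" using Vsp_sub h by blast
    have lift: "linear_on (span B) (lift h)" using lift_lin h B by simp
    have S_span: "S = span (lift h ` B)"
      unfolding S_def B(2)[symmetric] by (rule linear_on_span_image[OF lift B(1)])
    have finS: "finite (lift h ` B)" using B(1) by simp
    have subS: "subspace S" by (simp add: S_span)
    have subT: "subspace T" unfolding T_def
      by (rule subspace_lift_plus_Z) (use subS S_def bounded_linear.linear[OF embZ_lin] in auto)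
    have ST: "S \<subseteq> T"
    proof
      fix x assume "x \<in> S"
      then have "x + embZ 0 \<in> T" unfolding T_def lift_plus_Z_def S_def by blast
      then show "x \<in> T" using linear_0[OF bounded_linear.linear[OF embZ_lin]] by simp
    qed
    have ZT: "embZ z \<in> T" for z
    proof -
      have "0 + embZ z \<in> T" using subspace_0[OF subS] unfolding T_def lift_plus_Z_def S_def by blast
      then show ?thesis by simp
    qed
    have il_T: "linear_on T il" using invl_lin h by (auto simp: T_def il_def)
    have il_S: "linear_on (span (lift h ` B)) il"
      using linear_on_subset[OF il_T ST] by (simp add: S_span)
    have il_Vh: "il x \<in> Vh h" if "x \<in> T" for x using invl_into h that by (auto simp: T_def il_def)
    have il_lift: "il (lift h \<xi>) = \<xi>" if "\<xi> \<in> Vsp h" for \<xi>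
      using invl_ext h that by (auto simp: il_def)
    have il_Vsp: "il x \<in> Vsp h" and lift_il: "lift h (il x) = x" if "x \<in> S" for x
      using that il_lift by (auto simp: S_def)
    have N0: "0 \<le> N \<xi>" if "\<xi> \<in> Vsp h" for \<xi>
      using ip Vsp_Vh that by (auto simp: N_def ip_norm_def inner_product_on_def)
    have N_lower: "N (il x) \<le> (1 / cL1) * norm x" if "x \<in> S" for x
    proof -
      have "cL1 * N (il x) \<le> norm (lift h (il x))" using lift_V h il_Vsp[OF that] unfolding N_def by blast
      then show ?thesis using lift_il[OF that] cL1_pos by (simp add: field_simps)
    qed
    have N_upper: "norm (lift h \<xi>) \<le> cL * N \<xi>" if "\<xi> \<in> Vsp h" for \<xi>
    proof -
      have "norm (lift h \<xi>) \<le> cL2 * N \<xi>" using lift_V h that unfolding N_def by blast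
      also have "\<dots> \<le> cL * N \<xi>" by (intro mult_right_mono N0 that) (simp add: cL_def)
      finally show ?thesis .
    qed
    have ip_lin: "linear_on (span B) (\<lambda>x. ipV h x y)" "linear_on (span B) (ipV h y)" if "y \<in> span B" for y
      using inner_product_on_linear[OF ip subspace_span _ that] B(2) Vsp_Vh by auto
    \<comment> \<open>\<open>U_sol\<close> admits only test functions that are square-integrable in
      the discrete norm. Measurability of that norm along \<open>w\<close> comes from the bilinear
      expansion in a basis, integrability from the lower bound in (L2).\<close>
    have il_L2: "(\<lambda>\<omega>. il (w \<omega>)) \<in> L2 P N (Vsp h)" if w: "w \<in> L2 P norm S" for w
    proof (rule L2_I)
      show m: "(\<lambda>\<omega>. il (w \<omega>)) \<in> borel_measurable P"
        using L2_in[OF w] by (intro linear_on_finite_span_measurable[OF finS il_S L2_measurable[OF w]]) (simp add: S_span)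
      show in_V: "il (w \<omega>) \<in> Vsp h" if "\<omega> \<in> space P" for \<omega> using il_Vsp[OF L2_in[OF w that]] .
      have "(\<lambda>\<omega>. ipV h (il (w \<omega>)) (il (w \<omega>))) \<in> borel_measurable P"
        by (rule bilinear_on_finite_span_measurable[OF B(1) ip_lin m _ m]) (use in_V B(2) in auto)
      then have Nm: "(\<lambda>\<omega>. (N (il (w \<omega>)))\<^sup>2) \<in> borel_measurable P"
        unfolding N_def ip_norm_def by measurable
      have "integrable P (\<lambda>\<omega>. (1 / cL1)\<^sup>2 * (norm (w \<omega>))\<^sup>2)" using L2_integrable[OF w] by simp
      then show "integrable P (\<lambda>\<omega>. (N (il (w \<omega>)))\<^sup>2)"
      proof (rule Bochner_Integration.integrable_bound[OF _ Nm])
        have "(N (il (w \<omega>)))\<^sup>2 \<le> (1 / cL1)\<^sup>2 * (norm (w \<omega>))\<^sup>2" if "\<omega> \<in> space P" for \<omega>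
          using power_mono[OF N_lower[OF L2_in[OF w that]] N0[OF in_V[OF that]], of 2]
          by (simp add: power_mult_distrib power_divide)
        then show "AE \<omega> in P. norm ((N (il (w \<omega>)))\<^sup>2) \<le> norm ((1 / cL1)\<^sup>2 * (norm (w \<omega>))\<^sup>2)"
          by (intro AE_I2) simp
      qed
    qed
    define uh where "uh \<omega> = lift h (U h \<omega>)" for \<omega>
    have U: "U h \<in> L2 P N (Vsp h)" using U_L2 h by (simp add: N_def)
    have uh: "uh \<in> L2 P norm S" unfolding uh_def
    proof (rule L2_dominated_mem[OF _ _ U])
      show "(\<lambda>\<omega>. lift h (U h \<omega>)) \<in> borel_measurable P"
        using L2_in[OF U] B(2) by (intro linear_on_finite_span_measurable[OF B(1) lift L2_measurable[OF U]]) simp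
      show "lift h (U h \<omega>) \<in> S" if "\<omega> \<in> space P" for \<omega> using L2_in[OF U that] by (simp add: S_def)
      show "norm (lift h (U h \<omega>)) \<le> cL * N (U h \<omega>)" if "\<omega> \<in> space P" for \<omega>
        by (rule N_upper[OF L2_in[OF U that]])
    qed (simp add: cL_def)
    have A_uh: "A uh \<phi> = lform P (lht h) (\<lambda>\<omega>. il (\<phi> \<omega>))" if \<phi>: "\<phi> \<in> L2 P norm S" for \<phi>
    proof -
      have "A uh \<phi> = bform P (aht h) (U h) (\<lambda>\<omega>. il (\<phi> \<omega>))"
        unfolding A_def bform_def
        by (rule Bochner_Integration.integral_cong) (auto simp: uh_def il_lift[OF L2_in[OF U]])
      also have "\<dots> = lform P (lht h) (\<lambda>\<omega>. il (\<phi> \<omega>))" using U_sol h il_L2[OF \<phi>] by (simp add: N_def)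
      finally show ?thesis .
    qed
    have A_int: "integrable P (\<lambda>\<omega>. aht h \<omega> (il (w \<omega>)) (il (\<phi> \<omega>)))"
      if "w \<in> L2 P norm T" "\<phi> \<in> L2 P norm T" for w \<phi>
      using ahl_def h that unfolding T_def il_def by blast
    have diff_T: "(\<lambda>\<omega>. x \<omega> - y \<omega>) \<in> L2 P norm T" if "x \<in> L2 P norm T" "y \<in> L2 P norm T" for x y
      by (rule L2_restrict[OF L2_diff[OF that]]) (intro subspace_diff[OF subT] L2_in[OF that(1)] L2_in[OF that(2)])
    have diff_S: "(\<lambda>\<omega>. x \<omega> - y \<omega>) \<in> L2 P norm S" if "x \<in> L2 P norm S" "y \<in> L2 P norm S" for x y
      by (rule L2_restrict[OF L2_diff[OF that]]) (intro subspace_diff[OF subS] L2_in[OF that(1)] L2_in[OF that(2)])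
    have A_diff: "A (\<lambda>\<omega>. x \<omega> - y \<omega>) z = A x z - A y z" "A z (\<lambda>\<omega>. x \<omega> - y \<omega>) = A z x - A z y"
      if xyz: "x \<in> L2 P norm T" "y \<in> L2 P norm T" "z \<in> L2 P norm T" for x y z
    proof -
      have bil: "bilinear_on (Vh h) (aht h \<omega>)" if "\<omega> \<in> space P" for \<omega> using ah_bil h that by blast
      have il_diff: "il (x \<omega> - y \<omega>) = il (x \<omega>) - il (y \<omega>)" if "\<omega> \<in> space P" for \<omega>
        by (rule linear_on_diff[OF il_T subT L2_in[OF xyz(1) that] L2_in[OF xyz(2) that]])
      note pt = bilinear_on_diff[OF bil Vh il_Vh[OF L2_in[OF xyz(1)]] il_Vh[OF L2_in[OF xyz(2)]] il_Vh[OF L2_in[OF xyz(3)]]]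
      show "A (\<lambda>\<omega>. x \<omega> - y \<omega>) z = A x z - A y z" unfolding A_def
      proof (rule bform_diff_left)
        show "aht h \<omega> (il (x \<omega> - y \<omega>)) (il (z \<omega>))
            = aht h \<omega> (il (x \<omega>)) (il (z \<omega>)) - aht h \<omega> (il (y \<omega>)) (il (z \<omega>))" if "\<omega> \<in> space P" for \<omega>
          using pt(1)[OF that that that that] il_diff[OF that] by simp
      qed (rule A_int[OF xyz(1,3)] A_int[OF xyz(2,3)])+
      show "A z (\<lambda>\<omega>. x \<omega> - y \<omega>) = A z x - A z y" unfolding A_def
      proof (rule bform_diff_right)
        show "aht h \<omega> (il (z \<omega>)) (il (x \<omega> - y \<omega>))
            = aht h \<omega> (il (z \<omega>)) (il (x \<omega>)) - aht h \<omega> (il (z \<omega>)) (il (y \<omega>))" if "\<omega> \<in> space P" for \<omega>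
          using pt(2)[OF that that that that] il_diff[OF that] by simp
      qed (rule A_int[OF xyz(3,1)] A_int[OF xyz(3,2)])+
    qed
    have a_diff: "bform P acont (\<lambda>\<omega>. x \<omega> - y \<omega>) z = bform P acont x z - bform P acont y z"
      "bform P acont z (\<lambda>\<omega>. x \<omega> - y \<omega>) = bform P acont z x - bform P acont z y"
      if "x \<in> L2 P norm T1" "y \<in> L2 P norm T2" "z \<in> L2 P norm T3" for x y z T1 T2 T3
      using that by (auto intro!: fun_bilinear_on_diff[OF a_bil] elim: L2_mono)
    have P2': "\<bar>bform P acont w \<phi> - A w \<phi>\<bar> \<le> \<bar>cP2\<bar> * h * ?n w * ?n \<phi>"
      if "w \<in> L2 P norm T" "\<phi> \<in> L2 P norm T" for w \<phi>
    proof -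
      have "\<bar>bform P acont w \<phi> - A w \<phi>\<bar> \<le> cP2 * h * ?n w * ?n \<phi>"
        using P2 h that unfolding T_def A_def il_def by blast
      also have "\<dots> \<le> \<bar>cP2\<bar> * h * ?n w * ?n \<phi>"
        using h_pos by (intro mult_right_mono L2norm_nonneg) auto
      finally show ?thesis .
    qed
    \<comment> \<open>\<open>ah_bdd\<close> covers only arguments in \<open>Vsp h\<close>, which
      inverse lifts of Z_0 functions may leave. On \<open>T\<close> the bound comes from that of
      \<open>a\<close> and (P2).\<close>
    have A_bdd: "\<bar>A w \<phi>\<bar> \<le> (\<bar>Ca\<bar> + \<bar>cP2\<bar> * h0) * ?n w * ?n \<phi>"
      if "w \<in> L2 P norm T" "\<phi> \<in> L2 P norm T" for w \<phi>
    proof -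
      have "\<bar>A w \<phi>\<bar> \<le> \<bar>Ca\<bar> * ?n w * ?n \<phi> + \<bar>cP2\<bar> * h * ?n w * ?n \<phi>"
        using P2'[OF that] a_bdd'[OF L2_mono[OF that(1)] L2_mono[OF that(2)]] by simp
      also have "\<dots> = (\<bar>Ca\<bar> + \<bar>cP2\<bar> * h) * ?n w * ?n \<phi>" by (simp add: algebra_simps)
      also have "\<dots> \<le> (\<bar>Ca\<bar> + \<bar>cP2\<bar> * h0) * ?n w * ?n \<phi>"
        using h_le by (intro mult_right_mono add_left_mono mult_left_mono L2norm_nonneg) auto
      finally show ?thesis .
    qed
    have P1': "\<bar>lform P lcont (\<lambda>\<omega>. emb (\<phi> \<omega>)) - lform P (lht h) (\<lambda>\<omega>. il (\<phi> \<omega>))\<bar> \<le> \<bar>cP1\<bar> * h\<^sup>2 * (kE * ?n \<phi>)"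
      if \<phi>: "\<phi> \<in> L2 P norm S" for \<phi>
    proof -
      have "\<bar>lform P lcont (\<lambda>\<omega>. emb (\<phi> \<omega>)) - lform P (lht h) (\<lambda>\<omega>. il (\<phi> \<omega>))\<bar>
          \<le> cP1 * h\<^sup>2 * ?n (\<lambda>\<omega>. emb (\<phi> \<omega>))"
        using P1 h \<phi> unfolding S_def il_def by blast
      also have "\<dots> \<le> \<bar>cP1\<bar> * h\<^sup>2 * (kE * ?n \<phi>)"
        by (intro mult_mono emb_norm[OF \<phi>] L2norm_nonneg) (auto simp: mult_right_mono)
      finally show ?thesis .
    qed
    \<comment> \<open>Coercivity holds pathwise in the discrete norm; the upper bound in (L2) brings
      it to \<open>V\<close> at the cost of \<open>cL^2\<close>.\<close>
    have A_coer: "c1 * (?n \<phi>)\<^sup>2 \<le> cL\<^sup>2 * A \<phi> \<phi>" if \<phi>: "\<phi> \<in> L2 P norm S" for \<phi>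
    proof -
      have \<phi>T: "\<phi> \<in> L2 P norm T" using \<phi> ST by (rule L2_mono)
      have "c1 * (norm (\<phi> \<omega>))\<^sup>2 \<le> cL\<^sup>2 * aht h \<omega> (il (\<phi> \<omega>)) (il (\<phi> \<omega>))" if \<omega>: "\<omega> \<in> space P" for \<omega>
      proof -
        have i: "il (\<phi> \<omega>) \<in> Vsp h" by (rule il_Vsp[OF L2_in[OF \<phi> \<omega>]])
        have "norm (\<phi> \<omega>) \<le> cL * N (il (\<phi> \<omega>))"
          using N_upper[OF i] lift_il[OF L2_in[OF \<phi> \<omega>]] by simp
        then have "(norm (\<phi> \<omega>))\<^sup>2 \<le> (cL * N (il (\<phi> \<omega>)))\<^sup>2" by (intro power_mono) auto
        then have "c1 * (norm (\<phi> \<omega>))\<^sup>2 \<le> c1 * (cL * N (il (\<phi> \<omega>)))\<^sup>2"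
          using c1_pos by (intro mult_left_mono) auto
        also have "\<dots> = cL\<^sup>2 * (c1 * (N (il (\<phi> \<omega>)))\<^sup>2)" by (simp add: power_mult_distrib)
        also have "\<dots> \<le> cL\<^sup>2 * aht h \<omega> (il (\<phi> \<omega>)) (il (\<phi> \<omega>))"
          using ah_coer h \<omega> i unfolding N_def by (intro mult_left_mono) auto
        finally show ?thesis .
      qed
      then have "(\<integral>\<omega>. c1 * (norm (\<phi> \<omega>))\<^sup>2 \<partial>P) \<le> (\<integral>\<omega>. cL\<^sup>2 * aht h \<omega> (il (\<phi> \<omega>)) (il (\<phi> \<omega>)) \<partial>P)"
        using L2_integrable[OF \<phi>] A_int[OF \<phi>T \<phi>T] by (intro integral_mono) auto
      then show ?thesis by (simp add: L2norm_power2 A_def bform_def)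
    qed

    \<comment> \<open>Orthogonal projection onto the lifted discrete space\<close>
    obtain Q where Q: "bounded_linear Q" "\<And>x. Q x \<in> S" "\<And>x y. y \<in> S \<Longrightarrow> (x - Q x) \<bullet> y = 0"
      using orthogonal_projection_finite_span[OF finS] unfolding S_span by blast
    have Q_mem: "(\<lambda>\<omega>. Q (embZ (z \<omega>))) \<in> L2 P norm S" if "z \<in> L2 P norm UNIV" for z
      by (rule L2_restrict[OF L2_bounded_linear[OF Q(1) embZ_L2[OF that]] Q(2)])
    have Q_norm: "?n (\<lambda>\<omega>. Q (embZ (z \<omega>))) \<le> kZ * L2norm P norm z" if z: "z \<in> L2 P norm UNIV" for z
      by (rule L2_dominated_norm[OF L2_measurable[OF Q_mem[OF z]] _ z kZ(1), of UNIV])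
        (auto intro: order_trans[OF orthogonal_projection_norms(1)[OF Q(2) Q(3) subS] kZ(2)])
    have Q_err: "?n (\<lambda>\<omega>. embZ (z \<omega>) - Q (embZ (z \<omega>))) \<le> \<bar>cI\<bar> * h * L2norm P norm z"
      if z: "z \<in> L2 P norm UNIV" for z
    proof (rule L2_dominated_norm[OF L2_measurable[OF L2_diff[OF embZ_L2[OF z] Q_mem[OF z]]] _ z, of UNIV])
      show "norm (embZ (z \<omega>) - Q (embZ (z \<omega>))) \<le> \<bar>cI\<bar> * h * norm (z \<omega>)" for \<omega>
      proof -
        let ?\<eta> = "z \<omega>"
        have I: "Ih h ?\<eta> \<in> S"
          "norm (emb (embZ ?\<eta> - Ih h ?\<eta>)) + h * norm (embZ ?\<eta> - Ih h ?\<eta>) \<le> cI * h\<^sup>2 * norm ?\<eta>"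
          using Ih_prop h unfolding S_def by blast+
        \<comment> \<open>Dropping the H-term of (I1) and dividing by \<open>h\<close> leaves order
          \<open>h\<close> in \<open>V\<close>.\<close>
        have "h * norm (embZ ?\<eta> - Ih h ?\<eta>) \<le> h * (cI * h * norm ?\<eta>)"
          using order_trans[OF add_increasing[OF norm_ge_zero order_refl] I(2)] by (simp add: power2_eq_square ac_simps)
        then have "norm (embZ ?\<eta> - Ih h ?\<eta>) \<le> cI * h * norm ?\<eta>" using h_pos by simp
        also have "\<dots> \<le> \<bar>cI\<bar> * h * norm ?\<eta>" using h_pos by (intro mult_right_mono) auto
        finally show ?thesis
          using orthogonal_projection_norms(2)[OF Q(2) Q(3) subS I(1), of "embZ ?\<eta>"] by simp
      qed
    qed (use h_pos in auto)
    have Z_T: "(\<lambda>\<omega>. embZ (z \<omega>)) \<in> L2 P norm T" if "z \<in> L2 P norm UNIV" for z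
      by (rule L2_restrict[OF embZ_L2[OF that] ZT])

    \<comment> \<open>Error in V\<close>
    define pu where "pu \<omega> = Q (ub \<omega>)" for \<omega>
    have pu: "pu \<in> L2 P norm S" unfolding pu_def ub_def by (rule Q_mem[OF uz])
    have ub_T: "ub \<in> L2 P norm T" unfolding ub_def by (rule Z_T[OF uz])
    have uh_T: "uh \<in> L2 P norm T" and pu_T: "pu \<in> L2 P norm T" using L2_mono[OF _ ST] uh pu by auto
    define e where "e \<omega> = uh \<omega> - pu \<omega>" for \<omega>
    define d where "d \<omega> = ub \<omega> - pu \<omega>" for \<omega>
    have e: "e \<in> L2 P norm S" unfolding e_def by (rule diff_S[OF uh pu])
    have e_T: "e \<in> L2 P norm T" using e ST by (rule L2_mono)
    have d_T: "d \<in> L2 P norm T" unfolding d_def by (rule diff_T[OF ub_T pu_T])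
    have d_norm: "?n d \<le> \<bar>cI\<bar> * h * R" using Q_err[OF uz] by (simp add: d_def[abs_def] pu_def ub_def R_def)
    have e_norm: "?n e \<le> C1 * h"
    proof -
      let ?K = "\<bar>cP1\<bar> * h0 * kE + \<bar>cP2\<bar> * kZ * R + (\<bar>Ca\<bar> + \<bar>cP2\<bar> * h0) * \<bar>cI\<bar> * R"
      \<comment> \<open>The lifted discrete equation evaluates \<open>A uh e\<close>, and the weak
        equation gives \<open>bform P acont ub e\<close>. Inserting \<open>ub\<close> leaves the two
        consistency errors and the projection error \<open>d\<close>.\<close>
      have "A e e = (lform P (lht h) (\<lambda>\<omega>. il (e \<omega>)) - lform P lcont (\<lambda>\<omega>. emb (e \<omega>)))
          + (bform P acont ub e - A ub e) + A d e"
        using A_diff(1)[OF uh_T pu_T e_T] A_diff(1)[OF ub_T pu_T e_T] A_uh[OF e] ub_sol[OF L2_mono[OF e]]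
        by (simp add: e_def[abs_def] d_def[abs_def])
      also have "\<dots> \<le> \<bar>cP1\<bar> * h\<^sup>2 * (kE * ?n e) + \<bar>cP2\<bar> * h * ?n ub * ?n e
          + (\<bar>Ca\<bar> + \<bar>cP2\<bar> * h0) * ?n d * ?n e"
        using P1'[OF e] P2'[OF ub_T e_T] A_bdd[OF d_T e_T] by linarith
      also have "\<dots> \<le> \<bar>cP1\<bar> * (h0 * h) * (kE * ?n e) + \<bar>cP2\<bar> * h * (kZ * R) * ?n e
          + (\<bar>Ca\<bar> + \<bar>cP2\<bar> * h0) * (\<bar>cI\<bar> * h * R) * ?n e"
        using h_pos h_le h0_pos kE(1) ub_norm d_norm
        by (intro add_mono mult_right_mono mult_left_mono L2norm_nonneg) (auto simp: power2_eq_square L2norm_nonneg)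
      also have "\<dots> = ?K * h * ?n e" by (simp add: algebra_simps)
      finally have "cL\<^sup>2 * A e e \<le> cL\<^sup>2 * (?K * h * ?n e)" by (intro mult_left_mono) auto
      then have "c1 * (?n e)\<^sup>2 \<le> cL\<^sup>2 * (?K * h * ?n e)" using A_coer[OF e] by linarith
      then have "c1 * ?n e * ?n e \<le> cL\<^sup>2 * ?K * h * ?n e" by (simp add: power2_eq_square ac_simps)
      then have "c1 * ?n e \<le> cL\<^sup>2 * ?K * h \<or> ?n e = 0" using L2norm_nonneg[of P norm e] by auto
      then show ?thesis
      proof
        assume "c1 * ?n e \<le> cL\<^sup>2 * ?K * h"
        then show ?thesis using c1_pos unfolding C1_def by (simp add: field_simps)
      qed (use C1 h_pos in auto)
    qed

    \<comment> \<open>Duality argument in H\<close>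
    define E where "E \<omega> = ub \<omega> - uh \<omega>" for \<omega>
    have E_T: "E \<in> L2 P norm T" unfolding E_def by (rule diff_T[OF ub_T uh_T])
    have E_norm: "?n E \<le> C2 * h"
    proof -
      have "?n E = ?n (\<lambda>\<omega>. d \<omega> + (-1) *\<^sub>R e \<omega>)" by (simp add: E_def[abs_def] d_def e_def)
      also have "\<dots> \<le> ?n d + ?n (\<lambda>\<omega>. (-1) *\<^sub>R e \<omega>)" by (rule L2norm_triangle[OF d_T L2_scaleR[OF e]])
      also have "?n (\<lambda>\<omega>. (-1) *\<^sub>R e \<omega>) = ?n e" by (simp add: L2norm_def)
      finally show ?thesis using d_norm e_norm by (simp add: C2_def algebra_simps)
    qed
    define g where "g \<omega> = emb (E \<omega>)" for \<omega>
    have g: "g \<in> L2 P norm UNIV" unfolding g_def by (rule emb_L2[OF E_T])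
    have g_norm: "?n g \<le> C3 * h\<^sup>2"
    proof -
      obtain wz where wz: "wz \<in> L2 P norm UNIV" "L2norm P norm wz \<le> \<bar>cR\<bar> * ?n g"
        and w_sol: "\<And>\<phi>. \<phi> \<in> ?V \<Longrightarrow> bform P acont \<phi> (\<lambda>\<omega>. embZ (wz \<omega>)) = (\<integral>\<omega>. g \<omega> \<bullet> emb (\<phi> \<omega>) \<partial>P)"
        using dual[OF g] by blast
      define W where "W = L2norm P norm wz"
      have W0: "0 \<le> W" by (simp add: W_def L2norm_nonneg)
      define wb where "wb \<omega> = embZ (wz \<omega>)" for \<omega>
      define pw where "pw \<omega> = Q (wb \<omega>)" for \<omega>
      define r where "r \<omega> = wb \<omega> - pw \<omega>" for \<omega>
      have wb_T: "wb \<in> L2 P norm T" unfolding wb_def by (rule Z_T[OF wz(1)])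
      have pw: "pw \<in> L2 P norm S" unfolding pw_def wb_def by (rule Q_mem[OF wz(1)])
      have pw_T: "pw \<in> L2 P norm T" using pw ST by (rule L2_mono)
      have r_T: "r \<in> L2 P norm T" unfolding r_def by (rule diff_T[OF wb_T pw_T])
      have pw_norm: "?n pw \<le> kZ * W" using Q_norm[OF wz(1)] by (simp add: pw_def[abs_def] wb_def W_def)
      have r_norm: "?n r \<le> \<bar>cI\<bar> * h * W" using Q_err[OF wz(1)] by (simp add: r_def[abs_def] pw_def wb_def W_def)
      \<comment> \<open>The dual equation with right-hand side \<open>g\<close> is tested with
        \<open>E\<close>, and \<open>emb\<close> of \<open>E\<close> is \<open>g\<close>
        itself.\<close>
      have "(?n g)\<^sup>2 = bform P acont E wb"
        using w_sol[OF L2_mono[OF E_T]] by (simp add: L2norm_power2 g_def wb_def[abs_def] dot_square_norm)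
      \<comment> \<open>(P2) at \<open>(ub, pw)\<close> would give only order \<open>h\<close>.
        Writing \<open>pw = wb - r\<close> leaves \<open>(ub, r)\<close>, where \<open>r\<close>
        contributes a second factor \<open>h\<close>, and \<open>(ub, wb)\<close>, where both
        arguments come from Z_0 and (P3) applies. The pair \<open>(E, pw)\<close> gains its second
        factor from the error in \<open>V\<close>.\<close>
      also have "\<dots> = bform P acont E r
          + (lform P lcont (\<lambda>\<omega>. emb (pw \<omega>)) - lform P (lht h) (\<lambda>\<omega>. il (pw \<omega>)))
          + (bform P acont E pw - A E pw) + (bform P acont ub r - A ub r)
          - (bform P acont ub wb - A ub wb)"
        using a_diff(2)[OF wb_T pw_T E_T] a_diff(1)[OF ub_T uh_T pw_T] A_diff(1)[OF ub_T uh_T pw_T]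
          a_diff(2)[OF wb_T pw_T ub_T] A_diff(2)[OF wb_T pw_T ub_T] A_uh[OF pw] ub_sol[OF L2_mono[OF pw]]
        by (simp add: E_def[abs_def] r_def[abs_def])
      also have "\<dots> \<le> \<bar>Ca\<bar> * ?n E * ?n r + \<bar>cP1\<bar> * h\<^sup>2 * (kE * ?n pw) + \<bar>cP2\<bar> * h * ?n E * ?n pw
          + \<bar>cP2\<bar> * h * ?n ub * ?n r + \<bar>cP3\<bar> * h\<^sup>2 * R * W"
      proof -
        have "\<bar>bform P acont ub wb - A ub wb\<bar> \<le> cP3 * h\<^sup>2 * R * W"
          using P3 h uz wz(1) unfolding A_def il_def ub_def wb_def R_def W_def by blast
        also have "\<dots> \<le> \<bar>cP3\<bar> * h\<^sup>2 * R * W" by (intro mult_right_mono R0 W0) auto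
        finally show ?thesis
          using abs_le_D1[OF a_bdd'[OF L2_mono[OF E_T subset_UNIV] L2_mono[OF r_T subset_UNIV]]]
            abs_le_D1[OF P1'[OF pw]] abs_le_D1[OF P2'[OF E_T pw_T]] abs_le_D1[OF P2'[OF ub_T r_T]]
          by linarith
      qed
      also have "\<dots> \<le> \<bar>Ca\<bar> * (C2 * h) * (\<bar>cI\<bar> * h * W) + \<bar>cP1\<bar> * h\<^sup>2 * (kE * (kZ * W))
          + \<bar>cP2\<bar> * h * (C2 * h) * (kZ * W) + \<bar>cP2\<bar> * h * (kZ * R) * (\<bar>cI\<bar> * h * W) + \<bar>cP3\<bar> * h\<^sup>2 * R * W"
        using h_pos C2 kE(1) kZ(1) R0 W0
        by (intro add_mono mult_mono E_norm r_norm pw_norm ub_norm order_refl) (auto simp: L2norm_nonneg)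
      also have "\<dots> = D * h\<^sup>2 * W" by (simp add: D_def algebra_simps power2_eq_square)
      \<comment> \<open>Regularity trades the Z_0-norm of the dual solution for \<open>?n g\<close>,
        one factor of which then cancels.\<close>
      also have "\<dots> \<le> D * h\<^sup>2 * (\<bar>cR\<bar> * ?n g)"
        using D wz(2) unfolding W_def by (intro mult_left_mono) auto
      finally have "?n g * ?n g \<le> C3 * h\<^sup>2 * ?n g" by (simp add: C3_def power2_eq_square ac_simps)
      then have "?n g \<le> C3 * h\<^sup>2 \<or> ?n g = 0" using L2norm_nonneg[of P norm g] by auto
      then show ?thesis using C3 by auto
    qed
    show ?thesis
      using L2_mono[OF uh] E_norm g_norm by (simp add: uh_def[abs_def] E_def[abs_def] g_def[abs_def])
  qed

  \<comment> \<open>Combination with the sampling error\<close>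
  define C where "C = C2 + C3 + C4 + kE * C4"
  have C_ge: "C2 \<le> C" "C3 \<le> C" "C4 \<le> C" "kE * C4 \<le> C"
    using C2 C3 C4 mult_nonneg_nonneg[OF kE(1) C4] by (simp_all add: C_def)
  have "L2norm (PiM {..<m} (\<lambda>_. P)) norm
             (\<lambda>\<omega>s. emb ((\<integral>\<omega>. u \<omega> \<partial>P) - mc_mean m (\<lambda>\<omega>. lift h (U h \<omega>)) \<omega>s))
             \<le> C * (h\<^sup>2 + 1 / sqrt (real m))
         \<and> L2norm (PiM {..<m} (\<lambda>_. P)) norm
             (\<lambda>\<omega>s. (\<integral>\<omega>. u \<omega> \<partial>P) - mc_mean m (\<lambda>\<omega>. lift h (U h \<omega>)) \<omega>s)
             \<le> C * (h + 1 / sqrt (real m))"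
    if h: "h \<in> {0<..<h0}" and m: "m \<ge> 1" for h and m :: nat
  proof -
    have h_pos: "0 < h" and h_le: "h \<le> h0" using h by auto
    define uh where "uh \<omega> = lift h (U h \<omega>)" for \<omega>
    have uh: "uh \<in> ?V" and E_norm: "?n (\<lambda>\<omega>. ub \<omega> - uh \<omega>) \<le> C2 * h"
      and g_norm: "?n (\<lambda>\<omega>. emb (ub \<omega> - uh \<omega>)) \<le> C3 * h\<^sup>2"
      using discr[OF h] by (auto simp: uh_def[abs_def])
    have E: "(\<lambda>\<omega>. ub \<omega> - uh \<omega>) \<in> ?V" by (rule L2_diff[OF ub uh])
    have iu: "integrable P u" and iub: "integrable P ub" and iuh: "integrable P uh"
      using L2_prob_integrable(1)[OF prob] u_L2 ub uh by blast+
    have mean_u: "(\<integral>\<omega>. u \<omega> \<partial>P) = (\<integral>\<omega>. ub \<omega> \<partial>P)"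
      using iu iub u_ub by (intro integral_cong_AE) auto
    have mean_diff: "(\<integral>\<omega>. u \<omega> \<partial>P) - (\<integral>\<omega>. uh \<omega> \<partial>P) = (\<integral>\<omega>. ub \<omega> - uh \<omega> \<partial>P)"
      using iub iuh by (simp add: mean_u)
    have uh_norm: "?n uh \<le> C4"
    proof -
      have "?n uh = ?n (\<lambda>\<omega>. ub \<omega> + (-1) *\<^sub>R (ub \<omega> - uh \<omega>))" by simp
      also have "\<dots> \<le> ?n ub + ?n (\<lambda>\<omega>. (-1) *\<^sub>R (ub \<omega> - uh \<omega>))" by (rule L2norm_triangle[OF ub L2_scaleR[OF E]])
      also have "?n (\<lambda>\<omega>. (-1) *\<^sub>R (ub \<omega> - uh \<omega>)) = ?n (\<lambda>\<omega>. ub \<omega> - uh \<omega>)"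
        by (simp add: L2norm_def norm_minus_commute)
      finally show ?thesis
        using ub_norm E_norm mult_left_mono[OF h_le C2] by (simp add: C4_def)
    qed
    \<comment> \<open>\<open>x\<close> is the bias, of order \<open>t\<close>, and \<open>y\<close>
      the norm of a sample; the same arithmetic serves \<open>V\<close> with \<open>t = h\<close>
      and \<open>H\<close> with \<open>t = h^2\<close>.\<close>
    have final: "x + y / sqrt (real m) \<le> C * (t + 1 / sqrt (real m))"
      if "x \<le> K * t" "K \<le> C" "y \<le> C" "0 \<le> t" for x y K t
    proof -
      have "x + y / sqrt (real m) \<le> C * t + C / sqrt (real m)"
        using that order_trans[OF that(1) mult_right_mono[OF that(2,4)]] by (intro add_mono divide_right_mono) auto
      then show ?thesis by (simp add: algebra_simps)
    qed
    have V: "L2norm (PiM {..<m} (\<lambda>_. P)) norm (\<lambda>\<omega>s. (\<integral>\<omega>. u \<omega> \<partial>P) - mc_mean m uh \<omega>s)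
        \<le> C * (h + 1 / sqrt (real m))"
    proof (rule order_trans[OF Monte_Carlo_error[OF prob uh m]], rule final)
      show "norm ((\<integral>\<omega>. u \<omega> \<partial>P) - (\<integral>\<omega>. uh \<omega> \<partial>P)) \<le> C2 * h"
        unfolding mean_diff using L2_prob_integrable(2)[OF prob E] E_norm by simp
    qed (use h_pos order_trans[OF uh_norm C_ge(3)] C_ge in auto)
    note lin = bounded_linear.linear[OF emb_lin]
    \<comment> \<open>\<open>emb\<close> commutes with the estimator, so the estimate in
      \<open>H\<close> is the same sampling bound for the embedded samples.\<close>
    have emb_mc: "emb ((\<integral>\<omega>. u \<omega> \<partial>P) - mc_mean m uh \<omega>s) = emb (\<integral>\<omega>. u \<omega> \<partial>P) - mc_mean m (\<lambda>\<omega>. emb (uh \<omega>)) \<omega>s" for \<omega>s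
      unfolding mc_mean_def linear_diff[OF lin] linear_scale[OF lin] linear_sum[OF lin] ..
    have "L2norm (PiM {..<m} (\<lambda>_. P)) norm (\<lambda>\<omega>s. emb ((\<integral>\<omega>. u \<omega> \<partial>P) - mc_mean m uh \<omega>s))
        \<le> C * (h\<^sup>2 + 1 / sqrt (real m))"
      unfolding emb_mc
    proof (rule order_trans[OF Monte_Carlo_error[OF prob emb_L2[OF uh] m]], rule final)
      have "emb (\<integral>\<omega>. u \<omega> \<partial>P) - (\<integral>\<omega>. emb (uh \<omega>) \<partial>P) = (\<integral>\<omega>. emb (ub \<omega> - uh \<omega>) \<partial>P)"
        using integral_bounded_linear[OF emb_lin iuh] integral_bounded_linear[OF emb_lin L2_prob_integrable(1)[OF prob E]]
          mean_diff linear_diff[OF lin] by metis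
      then show "norm (emb (\<integral>\<omega>. u \<omega> \<partial>P) - (\<integral>\<omega>. emb (uh \<omega>) \<partial>P)) \<le> C3 * h\<^sup>2"
        using L2_prob_integrable(2)[OF prob emb_L2[OF E]] g_norm by simp
      have "?n (\<lambda>\<omega>. emb (uh \<omega>)) \<le> kE * C4"
        using emb_norm[OF uh] mult_left_mono[OF uh_norm kE(1)] by simp
      then show "?n (\<lambda>\<omega>. emb (uh \<omega>)) \<le> C" using C_ge(4) by simp
    qed (use C_ge in auto)
    with V show ?thesis by (simp add: uh_def[abs_def])
  qed
  then show ?thesis by blast
qed

end
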